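(* Let $q$ be a prime power and $n\ge2$. The nonzero eigenvalues of the digraphs $X_0(\mathbb{F}_q^n)$ and $X_2(\mathbb{F}_q^n)$ are each of the form $\zeta q^{s}$ with $\zeta$ a root of unity and $s\in\mathbb{Q}$.
   Context: Let $V$ be an $n$-dimensional vector space. $X_0(V)$ is the undirected graph (viewed as a digraph with edges in both directions) whose vertices $x_W$ are the nonzero proper subspaces $W$ of $V$, with an edge between $x_{W_1}$ and $x_{W_2}$ iff $W_1\oplus W_2=V$. A directed flag is an ordered pair $(W_1,W_2)$ of nonzero proper subspaces with $W_1\subsetneq W_2$ or $W_2\subsetneq W_1$. $X_2(V)$ is the digraph whose vertices are the directed flags, with a directed edge from $(W_1,W_2)$ to $(W_3,W_4)$ iff $W_2=W_3$ and either $W_1\oplus W_4=W_2$, or ($W_1\cap W_4=W_2$ and $W_1+W_4=V$). For a finite digraph $X$ with adjacency matrix $A$, the nonzero eigenvalues of $X$ are the nonzero eigenvalues of $A$; equivalently, writing $N_c(l)$ for the number of closed walks of length $l$ and $Z_c(X,u)=\exp(\sum_{l\ge1}N_c(l)u^l/l)$, one has $1/Z_c(X,u)=\det(1-Au)=\prod(1-\lambda_iu)$ and the nonzero eigenvalues are the nonzero $\lambda_i$. *)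

theory Defs
  imports
    "HOL-Analysis.Analysis"
    "Jordan_Normal_Form.Char_Poly"
    "Graph_Theory.Pair_Digraph"
begin

definition nonzero_proper_subspaces :: "('a::field ^ 'n) set \<Rightarrow> ('a ^ 'n) set set" where
  "nonzero_proper_subspaces V = {W. vec.subspace W \<and> W \<noteq> {0} \<and> W \<subset> V}"

text \<open>Internal direct sum of two subspaces; \<open>+\<close> on sets is the elementwise sum.\<close>

definition is_direct_sum :: "('a::field ^ 'n) set \<Rightarrow> ('a ^ 'n) set \<Rightarrow> ('a ^ 'n) set \<Rightarrow> bool" where
  "is_direct_sum W\<^sub>1 W\<^sub>2 U \<longleftrightarrow> W\<^sub>1 \<inter> W\<^sub>2 = {0} \<and> W\<^sub>1 + W\<^sub>2 = U"

text \<open>The arc set is symmetric, so this is an undirected graph viewed as a digraph.\<close>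

definition X0 :: "('a::field ^ 'n) set \<Rightarrow> ('a ^ 'n) set pair_pre_digraph" where
  "X0 V = \<lparr>pverts = nonzero_proper_subspaces V,
           parcs = {(W\<^sub>1, W\<^sub>2).
             W\<^sub>1 \<in> nonzero_proper_subspaces V \<and> W\<^sub>2 \<in> nonzero_proper_subspaces V \<and>
             is_direct_sum W\<^sub>1 W\<^sub>2 V}\<rparr>"

definition directed_flags ::
    "('a::field ^ 'n) set \<Rightarrow> (('a ^ 'n) set \<times> ('a ^ 'n) set) set" where
  "directed_flags V = {(W\<^sub>1, W\<^sub>2).
     W\<^sub>1 \<in> nonzero_proper_subspaces V \<and> W\<^sub>2 \<in> nonzero_proper_subspaces V \<and>
     (W\<^sub>1 \<subset> W\<^sub>2 \<or> W\<^sub>2 \<subset> W\<^sub>1)}"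

definition X2 ::
    "('a::field ^ 'n) set \<Rightarrow> (('a ^ 'n) set \<times> ('a ^ 'n) set) pair_pre_digraph" where
  "X2 V = \<lparr>pverts = directed_flags V,
           parcs = {((W\<^sub>1, W\<^sub>2), (W\<^sub>3, W\<^sub>4)).
             (W\<^sub>1, W\<^sub>2) \<in> directed_flags V \<and> (W\<^sub>3, W\<^sub>4) \<in> directed_flags V \<and>
             W\<^sub>2 = W\<^sub>3 \<and>
             (is_direct_sum W\<^sub>1 W\<^sub>4 W\<^sub>2 \<or> W\<^sub>1 \<inter> W\<^sub>4 = W\<^sub>2 \<and> W\<^sub>1 + W\<^sub>4 = V)}\<rparr>"

text \<open>The adjacency matrix with respect to an enumeration \<open>vs\<close> of the vertices.\<close>

definition adjacency_matrix :: "'v pair_pre_digraph \<Rightarrow> 'v list \<Rightarrow> complex mat" where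
  "adjacency_matrix G vs =
     mat (length vs) (length vs) (\<lambda>(i, j). if (vs ! i, vs ! j) \<in> parcs G then 1 else 0)"

text \<open>
  Different enumerations give matrices conjugate by a permutation matrix, so it does not
  matter which one is used.  The definition is meant for digraphs with finitely many vertices.
\<close>

definition nonzero_eigenvalues :: "'v pair_pre_digraph \<Rightarrow> complex set" where
  "nonzero_eigenvalues G =
     {\<mu>. \<mu> \<noteq> 0 \<and>
        (\<exists>vs. distinct vs \<and> set vs = pverts G \<and> eigenvalue (adjacency_matrix G vs) \<mu>)}"

definition root_of_unity :: "complex \<Rightarrow> bool" where
  "root_of_unity \<zeta> \<longleftrightarrow> (\<exists>m::nat. m > 0 \<and> \<zeta> ^ m = 1)"

end

theory Submission
  imports Defs
begin

text \<open>
  Call \<open>z\<close> a pure power if some \<open>z\<^sup>m\<close> with \<open>m > 0\<close> is an integral power of \<open>q\<close>; pure powers are closed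
  under products, inverses and roots.

  Suppose two operators \<open>P\<close>, \<open>Q\<close> satisfy \<open>PQP = QPQ\<close> and have only pure powers as eigenvalues.
  The full twist \<open>(QP)\<^sup>3\<close> commutes with both, so on its eigenspace for an eigenvalue \<open>z\<close>, of
  dimension \<open>d\<close>, taking determinants gives \<open>z\<^sup>d = det(P)\<^sup>3 det(Q)\<^sup>3\<close>; hence \<open>z\<close> is a pure power.

  In the lattice of subspaces let \<open>P\<close> and \<open>Q\<close> act on functions of flags \<open>A < x < y < B\<close> by summing over
  the complements of \<open>x\<close> in \<open>[A, y]\<close>, respectively of \<open>y\<close> in \<open>[x, B]\<close>. The modular law
  gives the braid relation. If \<open>S\<close> is the complement operator on the open interval \<open>(A, B)\<close>, then
  \<open>QPPQ\<close> acts as \<open>S\<^sup>2\<close> on functions of \<open>y\<close> alone, and \<open>PQQP\<close> acts as \<open>S\<^sup>2\<close> on functions of \<open>x\<close> alone. So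
  induction on the interval, starting from length two where \<open>S = J - I\<close> has eigenvalues
  \<open>-1\<close> and \<open>q\<close>, shows that all eigenvalues of \<open>S\<close> are pure powers. This is the claim for \<open>X\<^sub>0\<close>.
  The square of the adjacency operator of \<open>X\<^sub>2\<close> is \<open>PQ\<close> on increasing and \<open>QP\<close> on decreasing flags.
\<close>

section \<open>Products of roots of unity and powers of q, and determinants\<close>

text \<open>For q > 0 these are exactly the numbers zeta q^s of the claim, with s = k/m. One
  equation with integral exponents avoids choosing roots, and closure properties reduce to finding
  common exponents.\<close>

definition pure_power :: "nat \<Rightarrow> complex \<Rightarrow> bool" where
  "pure_power q z \<longleftrightarrow> (\<exists>m>0. \<exists>k::int. z ^ m = of_nat q powi k)"

lemma pure_power_1 [simp]: "pure_power q 1"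
  unfolding pure_power_def by (rule exI[of _ 1]) (auto intro: exI[of _ "0::int"])

lemma pure_power_minus_1 [simp]: "pure_power q (-1)"
  unfolding pure_power_def by (rule exI[of _ 2]) (auto intro: exI[of _ "0::int"])

lemma pure_power_of_nat [simp]: "pure_power q (of_nat q)"
  unfolding pure_power_def by (rule exI[of _ 1]) (auto intro: exI[of _ "1::int"])

lemma pure_power_nonzero: "q > 0 \<Longrightarrow> pure_power q z \<Longrightarrow> z \<noteq> 0"
  by (auto simp: pure_power_def power_0_left)

lemma pure_power_mult:
  assumes "q > 0" "pure_power q z" "pure_power q w"
  shows "pure_power q (z * w)"
proof -
  obtain m k where m: "m > 0" "z ^ m = of_nat q powi k" using assms(2) by (auto simp: pure_power_def)
  obtain l j where l: "l > 0" "w ^ l = of_nat q powi j" using assms(3) by (auto simp: pure_power_def)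
  have "(z * w) ^ (m * l) = (z ^ m) ^ l * (w ^ l) ^ m"
    by (simp add: power_mult_distrib mult.commute flip: power_mult)
  also have "\<dots> = of_nat q powi (k * int l + j * int m)"
    using assms(1) by (simp add: m l power_int_add flip: power_int_power')
  finally show ?thesis
    unfolding pure_power_def using m(1) l(1) by (metis nat_0_less_mult_iff)
qed

lemma pure_power_inverse:
  assumes "pure_power q z" shows "pure_power q (inverse z)"
proof -
  obtain m k where m: "m > 0" "z ^ m = of_nat q powi k" using assms by (auto simp: pure_power_def)
  have "inverse z ^ m = of_nat q powi (- k)"
    by (simp add: m(2) power_int_minus power_inverse)
  with m(1) show ?thesis unfolding pure_power_def by blast
qed

lemma pure_power_mult_cancel:
  assumes "q > 0" "pure_power q (z * w)" "pure_power q w"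
  shows "pure_power q z"
proof -
  have "pure_power q (z * w * inverse w)"
    using assms by (simp only: pure_power_mult pure_power_inverse)
  moreover have "z * w * inverse w = z"
    using pure_power_nonzero[OF assms(1,3)] by (simp add: mult.assoc)
  ultimately show ?thesis by metis
qed

lemma pure_power_power: "q > 0 \<Longrightarrow> pure_power q z \<Longrightarrow> pure_power q (z ^ d)"
  by (induction d) (auto intro: pure_power_mult)

lemma pure_power_root:
  assumes "pure_power q (z ^ d)" "d > 0"
  shows "pure_power q z"
proof -
  obtain m k where m: "m > 0" "(z ^ d) ^ m = of_nat q powi k" using assms by (auto simp: pure_power_def)
  with assms(2) show ?thesis unfolding pure_power_def
    by (metis nat_0_less_mult_iff power_mult)
qed

lemma pure_power_prod_list:
  "q > 0 \<Longrightarrow> (\<And>z. z \<in> set zs \<Longrightarrow> pure_power q z) \<Longrightarrow> pure_power q (prod_list zs)"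
  by (induction zs) (auto intro: pure_power_mult)

lemma pure_power_imp_root_of_unity_times_powr:
  assumes "q > 0" "pure_power q z"
  shows "\<exists>\<zeta> s. root_of_unity \<zeta> \<and> s \<in> \<rat> \<and> z = \<zeta> * complex_of_real (real q powr s)"
proof -
  obtain m k where m: "m > 0" "z ^ m = of_nat q powi k" using assms(2) by (auto simp: pure_power_def)
  \<comment> \<open>Absolute values in z^m = q^k give |z| = q^(k/m); zeta is the remaining factor of
    modulus one.\<close>
  define s where "s = real_of_int k / real m"
  define \<zeta> where "\<zeta> = z / complex_of_real (real q powr s)"
  have "(real q powr s) ^ m = real q powr of_int k"
    using m(1) assms(1) by (simp add: s_def powr_powr flip: powr_realpow)
  also have "\<dots> = real q powi k"
    using assms(1) by (simp add: powr_real_of_int')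
  finally have "complex_of_real (real q powr s) ^ m = of_nat q powi k"
    by (metis of_real_of_nat_eq of_real_power of_real_power_int)
  then have "\<zeta> ^ m = 1"
    using assms(1) by (simp add: \<zeta>_def power_divide m(2))
  then have "root_of_unity \<zeta>" unfolding root_of_unity_def using m(1) by blast
  moreover have "s \<in> \<rat>" by (simp add: s_def)
  moreover have "z = \<zeta> * complex_of_real (real q powr s)"
    using assms(1) by (simp add: \<zeta>_def)
  ultimately show ?thesis by blast
qed

section \<open>Coordinates and determinants on invariant subspaces\<close>

definition is_basis_family :: "(complex ^ 'x) set \<Rightarrow> nat \<Rightarrow> (nat \<Rightarrow> complex ^ 'x) \<Rightarrow> bool" where
  "is_basis_family E d b \<longleftrightarrow> (\<forall>i<d. b i \<in> E) \<and> (\<forall>v\<in>E. \<exists>c. v = (\<Sum>i<d. c i *s b i)) \<and>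
     (\<forall>c. (\<Sum>i<d. c i *s b i) = 0 \<longrightarrow> (\<forall>i<d. c i = 0))"

lemma basis_family_exists:
  fixes E :: "(complex ^ 'x) set"
  assumes "vec.subspace E"
  shows "\<exists>d b. is_basis_family E d b"
proof -
  obtain B where B: "B \<subseteq> E" "vec.independent B" "E \<subseteq> vec.span B"
    by (rule vec.basis_exists)
  have "finite B" using B(2) vec.finiteI_independent by blast
  then obtain d :: nat and b where b: "b ` {i. i < d} = B" "inj_on b {i. i < d}"
    using finite_imp_nat_seg_image_inj_on by metis
  have bB: "bij_betw b {..<d} B" using b by (simp add: bij_betw_def lessThan_def)
  have sum_b: "(\<Sum>i<d. c (b i) *s b i) = (\<Sum>v\<in>B. c v *s v)" for c
    using sum.reindex_bij_betw[OF bB, of "\<lambda>v. c v *s v"] .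
  have "is_basis_family E d b"
    unfolding is_basis_family_def
  proof (intro conjI allI impI ballI)
    fix v assume "v \<in> E"
    then obtain u where "v = (\<Sum>w\<in>B. u w *s w)"
      using B(3) vec.span_finite[OF \<open>finite B\<close>] by auto
    then show "\<exists>c. v = (\<Sum>i<d. c i *s b i)" using sum_b[of u] by (intro exI[of _ "\<lambda>i. u (b i)"]) simp
  next
    fix i assume "i < d" then show "b i \<in> E" using b(1) B(1) by auto
  next
    fix c :: "nat \<Rightarrow> complex" and j assume c: "(\<Sum>i<d. c i *s b i) = 0" and j: "j < d"
    \<comment> \<open>Independence speaks of coefficients on the set \<open>B\<close>, so they are
      carried over along the inverse of the enumeration \<open>b\<close>.\<close>
    define u where "u v = c (the_inv_into {i. i < d} b v)" for v
    have ub: "u (b i) = c i" if "i < d" for i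
      using the_inv_into_f_f[OF b(2), of i] that by (simp add: u_def)
    have "(\<Sum>v\<in>B. u v *s v) = 0"
      using c by (simp add: ub flip: sum_b)
    then have "\<forall>v\<in>B. u v = 0"
      using vec.independentD[OF B(2) \<open>finite B\<close> order_refl] by blast
    then show "c j = 0" using b(1) ub j by fastforce
  qed
  then show ?thesis by blast
qed

text \<open>Column j of the matrix holds the coordinates of \<open>P (b j)\<close>. Indexing a basis
  by i < d turns an operator restricted to \<open>E\<close> into a matrix for which determinants and
  characteristic polynomials are available.\<close>

lemma linear_map_matrix:
  fixes E :: "(complex ^ 'x) set" and P :: "complex ^ 'x \<Rightarrow> complex ^ 'x"
  assumes P: "Vector_Spaces.linear (*s) (*s) P" "\<And>v. v \<in> E \<Longrightarrow> P v \<in> E"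
    and bf: "is_basis_family E d b"
  shows "\<exists>A\<in>carrier_mat d d. \<forall>v\<in>carrier_vec d.
          P (\<Sum>i<d. vec_index v i *s b i) = (\<Sum>i<d. vec_index (A *\<^sub>v v) i *s b i)"
proof -
  interpret P: Vector_Spaces.linear "(*s)" "(*s)" P by (fact P(1))
  have "\<forall>j\<in>{..<d}. \<exists>c. P (b j) = (\<Sum>i<d. c i *s b i)" using bf P(2) by (auto simp: is_basis_family_def)
  then obtain c where c: "\<And>j. j < d \<Longrightarrow> P (b j) = (\<Sum>i<d. c j i *s b i)"
    unfolding bchoice_iff by auto
  define A where "A = Matrix.mat d d (\<lambda>(i, j). c j i)"
  show ?thesis
  proof (rule bexI[of _ A] ballI)+
    show "A \<in> carrier_mat d d" by (simp add: A_def)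
  next
    fix v :: "complex Matrix.vec" assume v: "v \<in> carrier_vec d"
    have "P (\<Sum>j<d. vec_index v j *s b j) = (\<Sum>j<d. vec_index v j *s (\<Sum>i<d. c j i *s b i))"
      by (simp add: P.sum P.scale c)
    also have "\<dots> = (\<Sum>j<d. \<Sum>i<d. (c j i * vec_index v j) *s b i)"
      by (simp add: vec.scale_sum_right mult.commute)
    also have "\<dots> = (\<Sum>i<d. \<Sum>j<d. (c j i * vec_index v j) *s b i)"
      by (rule sum.swap)
    also have "\<dots> = (\<Sum>i<d. vec_index (A *\<^sub>v v) i *s b i)"
      using v by (intro sum.cong refl)
        (simp add: A_def scalar_prod_def vec.scale_sum_left atLeast0LessThan)
    finally show "P (\<Sum>i<d. vec_index v i *s b i) = (\<Sum>i<d. vec_index (A *\<^sub>v v) i *s b i)" .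
  qed
qed

text \<open>The characteristic polynomial splits over the complex numbers; its value at 0 is
  det(-A), and the sign (-1)^d cancels on both sides.\<close>

lemma det_eq_prod_eigenvalues:
  fixes A :: "complex mat"
  assumes A: "A \<in> carrier_mat d d"
  shows "\<exists>as. Determinant.det A = prod_list as \<and> length as = d \<and> (\<forall>a\<in>set as. eigenvalue A a)"
proof -
  obtain as where as: "char_poly A = (\<Prod>a\<leftarrow>as. [:- a, 1:])" "length as = d"
    using char_poly_factorized[OF A] by blast
  have neg: "poly (\<Prod>a\<leftarrow>as. [:- a, 1:]) 0 = (-1) ^ length as * prod_list as"
    by (induction as) auto
  have "char_matrix A 0 = A" using A by (auto simp: char_matrix_def)
  then have "Determinant.det (- A) = (-1) ^ d * prod_list as"
    using char_poly_matrix[OF A, of 0] as neg by simp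
  moreover have "- A = (-1) \<cdot>\<^sub>m A" by auto
  then have "Determinant.det (- A) = (-1) ^ d * Determinant.det A"
    using A by (simp add: det_smult)
  ultimately have "Determinant.det A = prod_list as" by simp
  moreover have "eigenvalue A a" if "a \<in> set as" for a
  proof -
    have "poly (char_poly A) a = 0"
      unfolding as(1) using that by (induction as) auto
    then show ?thesis using eigenvalue_root_char_poly[OF A] by simp
  qed
  ultimately show ?thesis using as(2) by blast
qed

lemma eigenvector_in_invariant_subspace:
  fixes E :: "(complex ^ 'x) set"
  assumes E: "vec.subspace E" "v \<in> E" "v \<noteq> 0"
    and P: "Vector_Spaces.linear (*s) (*s) P" "\<And>v. v \<in> E \<Longrightarrow> P v \<in> E"
  obtains w \<mu> where "w \<in> E" "w \<noteq> 0" "P w = \<mu> *s w"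
proof -
  obtain d b where bf: "is_basis_family E d b" using basis_family_exists[OF E(1)] by blast
  have db: "\<And>v. v \<in> E \<Longrightarrow> \<exists>c. v = (\<Sum>i<d. c i *s b i)"
      "\<And>i. i < d \<Longrightarrow> b i \<in> E"
      "\<And>c. (\<Sum>i<d. c i *s b i) = 0 \<Longrightarrow> \<forall>i<d. c i = 0"
    using bf by (auto simp: is_basis_family_def)
  obtain A where A: "A \<in> carrier_mat d d"
    "\<And>v. v \<in> carrier_vec d \<Longrightarrow>
          P (\<Sum>i<d. vec_index v i *s b i) = (\<Sum>i<d. vec_index (A *\<^sub>v v) i *s b i)"
    using linear_map_matrix[OF P bf] by blast
  \<comment> \<open>A nonzero vector in \<open>E\<close> excludes dimension zero, so the list of the
    d eigenvalues has a member.\<close>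
  have "d \<noteq> 0" using db(1)[OF E(2)] E(3) by (cases d) auto
  obtain as where as: "length as = d" "\<And>a. a \<in> set as \<Longrightarrow> eigenvalue A a"
    using det_eq_prod_eigenvalues[OF A(1)] by blast
  then obtain \<mu> where "eigenvalue A \<mu>" using \<open>d \<noteq> 0\<close> by (cases as) auto
  then obtain c where c: "c \<in> carrier_vec d" "c \<noteq> 0\<^sub>v d" "A *\<^sub>v c = \<mu> \<cdot>\<^sub>v c"
    using A(1) by (auto simp: eigenvalue_def eigenvector_def)
  define w where "w = (\<Sum>i<d. vec_index c i *s b i)"
  have "w \<in> E" unfolding w_def
    using db(2) E(1) by (intro vec.subspace_sum vec.subspace_scale) auto
  moreover have "w \<noteq> 0" using db(3)[of "vec_index c"] c(1,2) by (auto simp: w_def intro!: eq_vecI)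
  moreover have "P w = \<mu> *s w"
    using A(2)[OF c(1)] c by (simp add: w_def vec.scale_sum_right)
  ultimately show ?thesis using that by blast
qed

text \<open>In coordinates the scalar operator has determinant z^d, which is also the cube of det(B)
  det(A). Both determinants are products of eigenvalues, hence pure powers, and z is a d-th root of
  a pure power.\<close>

lemma pure_power_scalar_of_cube:
  fixes E :: "(complex ^ 'x) set"
  assumes q: "q > 0"
    and E: "vec.subspace E" "v \<in> E" "v \<noteq> 0"
    and P: "Vector_Spaces.linear (*s) (*s) P" "\<And>v. v \<in> E \<Longrightarrow> P v \<in> E"
    and Q: "Vector_Spaces.linear (*s) (*s) Q" "\<And>v. v \<in> E \<Longrightarrow> Q v \<in> E"
    and ev_P: "\<And>w \<mu>. w \<in> E \<Longrightarrow> w \<noteq> 0 \<Longrightarrow> P w = \<mu> *s w \<Longrightarrow> pure_power q \<mu>"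
    and ev_Q: "\<And>w \<mu>. w \<in> E \<Longrightarrow> w \<noteq> 0 \<Longrightarrow> Q w = \<mu> *s w \<Longrightarrow> pure_power q \<mu>"
    and z: "\<And>v. v \<in> E \<Longrightarrow> Q (P (Q (P (Q (P v))))) = z *s v"
  shows "pure_power q z"
proof -
  obtain d b where bf: "is_basis_family E d b" using basis_family_exists[OF E(1)] by blast
  have db: "\<And>v. v \<in> E \<Longrightarrow> \<exists>c. v = (\<Sum>i<d. c i *s b i)"
      "\<And>i. i < d \<Longrightarrow> b i \<in> E"
      "\<And>c. (\<Sum>i<d. c i *s b i) = 0 \<Longrightarrow> \<forall>i<d. c i = 0"
    using bf by (auto simp: is_basis_family_def)
  define T where "T c = (\<Sum>i<d. vec_index c i *s b i)" for c
  have TE: "T c \<in> E" for c unfolding T_def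
    using db(2) E(1) by (intro vec.subspace_sum vec.subspace_scale) auto
  have T_inj: "c = c'" if "c \<in> carrier_vec d" "c' \<in> carrier_vec d" "T c = T c'" for c c'
    using that db(3)[of "\<lambda>i. vec_index c i - vec_index c' i"]
    by (auto simp: T_def vec.scale_left_diff_distrib sum_subtractf intro!: eq_vecI)
  have T_smult: "T (\<mu> \<cdot>\<^sub>v c) = \<mu> *s T c" if "c \<in> carrier_vec d" for \<mu> c
    using that by (simp add: T_def vec.scale_sum_right)
  have T_0: "T (0\<^sub>v d) = 0" by (simp add: T_def)
  have "d \<noteq> 0" using db(1)[OF E(2)] E(3) by (cases d) auto
  \<comment> \<open>The injective map \<open>T\<close> sends eigenvectors of the coordinate matrix
    to eigenvectors in \<open>E\<close>, so every factor of the determinant is a pure power.\<close>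
  have pp_det: "pure_power q (Determinant.det A)"
    if A: "A \<in> carrier_mat d d" "\<And>c. c \<in> carrier_vec d \<Longrightarrow> R (T c) = T (A *\<^sub>v c)"
      and ev: "\<And>w \<mu>. w \<in> E \<Longrightarrow> w \<noteq> 0 \<Longrightarrow> R w = \<mu> *s w \<Longrightarrow> pure_power q \<mu>" for R A
  proof -
    have "pure_power q \<mu>" if "eigenvalue A \<mu>" for \<mu>
    proof -
      obtain c where c: "c \<in> carrier_vec d" "c \<noteq> 0\<^sub>v d" "A *\<^sub>v c = \<mu> \<cdot>\<^sub>v c"
        using A(1) \<open>eigenvalue A \<mu>\<close> by (auto simp: eigenvalue_def eigenvector_def)
      then have "T c \<noteq> 0" using T_inj[of c "0\<^sub>v d"] T_0 by auto
      moreover have "R (T c) = \<mu> *s T c" using A(2) c T_smult by simp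
      ultimately show ?thesis using ev TE by blast
    qed
    then show ?thesis
      using det_eq_prod_eigenvalues[OF A(1)] pure_power_prod_list[OF q] by metis
  qed
  obtain A where A: "A \<in> carrier_mat d d" "\<And>c. c \<in> carrier_vec d \<Longrightarrow> P (T c) = T (A *\<^sub>v c)"
    using linear_map_matrix[OF P bf] unfolding T_def by blast
  obtain B where B: "B \<in> carrier_mat d d" "\<And>c. c \<in> carrier_vec d \<Longrightarrow> Q (T c) = T (B *\<^sub>v c)"
    using linear_map_matrix[OF Q bf] unfolding T_def by blast
  define C where "C = B * A"
  have C: "C \<in> carrier_mat d d" using A B by (simp add: C_def)
  have QP: "Q (P (T c)) = T (C *\<^sub>v c)" if "c \<in> carrier_vec d" for c
    using that A B by (simp add: C_def assoc_mult_mat_vec[OF B(1) A(1)])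
  \<comment> \<open>Columns are compared by applying both sides to unit vectors and using that
    \<open>T\<close> is injective.\<close>
  have "C * (C * C) = z \<cdot>\<^sub>m 1\<^sub>m d"
  proof (rule eq_matI)
    fix i j assume ij: "i < dim_row (z \<cdot>\<^sub>m 1\<^sub>m d)" "j < dim_col (z \<cdot>\<^sub>m 1\<^sub>m d)"
    have "T ((C * (C * C)) *\<^sub>v unit_vec d j) = T (C *\<^sub>v (C *\<^sub>v (C *\<^sub>v unit_vec d j)))"
      using C by (simp add: assoc_mult_mat_vec[of _ d d _ d])
    also have "\<dots> = Q (P (Q (P (Q (P (T (unit_vec d j)))))))"
      using C by (simp add: QP)
    also have "\<dots> = T (z \<cdot>\<^sub>v unit_vec d j)"
      using z[OF TE] by (simp add: T_smult)
    finally have "(C * (C * C)) *\<^sub>v unit_vec d j = z \<cdot>\<^sub>v unit_vec d j"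
      using C by (intro T_inj mult_mat_vec_carrier[of _ d d]) auto
    then have "vec_index ((C * (C * C)) *\<^sub>v unit_vec d j) i = vec_index (z \<cdot>\<^sub>v unit_vec d j) i"
      by simp
    then show "(C * (C * C)) $$ (i, j) = (z \<cdot>\<^sub>m 1\<^sub>m d) $$ (i, j)"
      using C ij by (auto simp: scalar_prod_right_unit[of _ d] simp del: assoc_mult_mat index_mult_mat(1))
  qed (use C in auto)
  then have "z ^ d = Determinant.det (C * (C * C))" by (simp add: det_smult)
  also have "\<dots> = Determinant.det C ^ 3"
    using C by (simp add: det_mult[of _ d] power3_eq_cube)
  finally have "z ^ d = (Determinant.det B * Determinant.det A) ^ 3"
    using A(1) B(1) by (simp add: det_mult[of _ d] C_def)
  moreover have "pure_power q \<dots>"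
    using pp_det[OF A ev_P] pp_det[OF B ev_Q] q by (intro pure_power_power pure_power_mult) auto
  ultimately show ?thesis using pure_power_root \<open>d \<noteq> 0\<close> by (metis gr0I)
qed


section \<open>Pairs of operators satisfying the braid relation\<close>

text \<open>The conditions are restricted to an invariant subspace \<open>V\<close> because the
  operators on flags defined below kill every function supported off the flags; only on
  \<open>V\<close> can all eigenvalues be pure powers.\<close>

locale braid_pair =
  fixes q :: nat and V :: "(complex ^ 'x) set" and P Q :: "complex ^ 'x \<Rightarrow> complex ^ 'x"
  assumes q: "q > 0"
    and V: "vec.subspace V"
    and linear_P: "Vector_Spaces.linear (*s) (*s) P" and linear_Q: "Vector_Spaces.linear (*s) (*s) Q"
    and P_in: "v \<in> V \<Longrightarrow> P v \<in> V" and Q_in: "v \<in> V \<Longrightarrow> Q v \<in> V"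
    and braid: "v \<in> V \<Longrightarrow> P (Q (P v)) = Q (P (Q v))"
    and ev_P: "v \<in> V \<Longrightarrow> v \<noteq> 0 \<Longrightarrow> P v = \<mu> *s v \<Longrightarrow> pure_power q \<mu>"
    and ev_Q: "v \<in> V \<Longrightarrow> v \<noteq> 0 \<Longrightarrow> Q v = \<mu> *s v \<Longrightarrow> pure_power q \<mu>"
begin

lemma swap: "braid_pair q V Q P"
  by (rule braid_pair.intro) (fact q V linear_P linear_Q P_in Q_in ev_P ev_Q braid[symmetric])+

interpretation P: Vector_Spaces.linear "(*s)" "(*s)" P by (fact linear_P)
interpretation Q: Vector_Spaces.linear "(*s)" "(*s)" Q by (fact linear_Q)

text \<open>The full twist is central in the braid group on three strands, so its eigenspace is
  invariant under \<open>P\<close> and \<open>Q\<close> and the determinant argument applies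
  there.\<close>

lemma pure_power_full_twist:
  assumes v: "v \<in> V" "v \<noteq> 0" and z: "Q (P (Q (P (Q (P v))))) = z *s v"
  shows "pure_power q z"
proof -
  define E where "E = {v \<in> V. Q (P (Q (P (Q (P v))))) = z *s v}"
  have E: "vec.subspace E"
    using V by (auto simp: E_def vec.subspace_def P.add Q.add P.scale Q.scale P.zero Q.zero
        vec.scale_right_distrib vec.scale_left_commute)
  have vE: "v \<in> E" using v z by (simp add: E_def)
  \<comment> \<open>Two braid moves carry the rightmost \<open>P\<close> of (QP)^3 P to the front:
    QPQ becomes PQP on the left, then PQP becomes QPQ further in.\<close>
  have PE: "P w \<in> E" if "w \<in> E" for w
  proof -
    have w: "w \<in> V" "Q (P (Q (P (Q (P w))))) = z *s w" using that by (auto simp: E_def)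
    have "Q (P (Q (P (Q (P (P w)))))) = P (Q (P (P (Q (P (P w))))))"
      using w(1) by (simp add: P_in Q_in braid[of "P (Q (P (P w)))"])
    also have "\<dots> = P (Q (P (Q (P (Q (P w))))))"
      using w(1) by (simp add: P_in Q_in braid[of "P w"])
    finally show ?thesis using w by (simp add: E_def P_in P.scale)
  qed
  have QE: "Q w \<in> E" if "w \<in> E" for w
  proof -
    have w: "w \<in> V" "Q (P (Q (P (Q (P w))))) = z *s w" using that by (auto simp: E_def)
    have "Q (P (Q (P (Q (P (Q w)))))) = Q (Q (P (Q (P (Q (P w))))))"
      using w(1) by (simp add: P_in Q_in braid[of "Q (P (Q w))"] braid[of w])
    then show ?thesis using w by (simp add: E_def Q_in Q.scale)
  qed
  show ?thesis
    by (rule pure_power_scalar_of_cube[OF q E vE v(2) linear_P PE linear_Q QE])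
      (auto simp: E_def intro: ev_P ev_Q)
qed

text \<open>On a common eigenvector of \<open>QPPQ\<close> and \<open>P\<close>, the full twist \<open>(QP)\<^sup>3 = QPPQ \<cdot> P\<^sup>2\<close> acts as
  \<open>z \<mu>\<^sup>2\<close>.\<close>

lemma pure_power_QPPQ:
  assumes v: "v \<in> V" "v \<noteq> 0" and z: "Q (P (P (Q v))) = z *s v"
  shows "pure_power q z"
proof -
  define E where "E = {v \<in> V. Q (P (P (Q v))) = z *s v}"
  have E: "vec.subspace E"
    using V by (auto simp: E_def vec.subspace_def P.add Q.add P.scale Q.scale P.zero Q.zero
        vec.scale_right_distrib vec.scale_left_commute)
  have vE: "v \<in> E" using v z by (simp add: E_def)
  \<comment> \<open>\<open>P\<close> commutes with \<open>QPPQ\<close> by two braid moves, so this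
    eigenspace contains an eigenvector of \<open>P\<close>.\<close>
  have PE: "P w \<in> E" if "w \<in> E" for w
  proof -
    have w: "w \<in> V" "Q (P (P (Q w))) = z *s w" using that by (auto simp: E_def)
    have "Q (P (P (Q (P w)))) = Q (P (Q (P (Q w))))"
      using w(1) by (simp add: braid[of w])
    also have "\<dots> = P (Q (P (P (Q w))))"
      using w(1) by (simp add: P_in Q_in braid[of "P (Q w)"])
    finally show ?thesis using w by (simp add: E_def P_in P.scale)
  qed
  obtain w \<mu> where w: "w \<in> E" "w \<noteq> 0" "P w = \<mu> *s w"
    using eigenvector_in_invariant_subspace[OF E vE v(2) linear_P PE] by blast
  then have w': "w \<in> V" "Q (P (P (Q w))) = z *s w" by (auto simp: E_def)
  have \<mu>: "pure_power q \<mu>" using ev_P w w' by blast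
  have "Q (P (Q (P (Q (P w))))) = Q (P (P (Q (P (P w)))))"
    using w'(1) by (simp add: P_in Q_in braid[of "P w"])
  also have "\<dots> = (z * \<mu> * \<mu>) *s w"
    using w w' by (simp add: P.scale Q.scale mult_ac)
  finally have "pure_power q (z * \<mu> * \<mu>)"
    using pure_power_full_twist w w' by blast
  then show ?thesis using pure_power_mult_cancel[OF q] \<mu> by blast
qed

end


section \<open>Flags in finite modular lattices\<close>

no_notation vec_index (infixl \<open>$\<close> 100)

class modular_lattice = lattice +
  assumes modular: "x \<le> z \<Longrightarrow> sup x (inf y z) = inf (sup x y) z"

text \<open>That \<open>x\<close> and \<open>u\<close> lie in the interval [A, B] follows from the
  two equations.\<close>

definition complements :: "'l::lattice \<Rightarrow> 'l \<Rightarrow> 'l \<Rightarrow> 'l set" where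
  "complements A B x = {u. inf x u = A \<and> sup x u = B}"

text \<open>If u = A then x = sup x u = B, and dually u = B gives x = A. This keeps all walks inside
  the open interval.\<close>

lemma complements_strict:
  assumes "u \<in> complements A B x" "A < x" "x < B"
  shows "A < u" "u < B"
proof -
  have u: "inf x u = A" "sup x u = B" using assms(1) by (auto simp: complements_def)
  have "u \<noteq> A" using u assms(2,3) by (auto simp: sup_absorb1)
  moreover have "A \<le> u" using u by auto
  ultimately show "A < u" by simp
  have "u \<noteq> B" using u assms(2,3) by (auto simp: inf_absorb1)
  moreover have "u \<le> B" using u by auto
  ultimately show "u < B" by simp
qed

definition complement_sum :: "'l::lattice \<Rightarrow> 'l \<Rightarrow> ('l \<Rightarrow> complex) \<Rightarrow> 'l \<Rightarrow> complex" where
  "complement_sum A B g x = (\<Sum>u\<in>complements A B x. g u)"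

text \<open>An eigenvalue of \<open>S\<close> on the open interval. Values of \<open>g\<close>
  elsewhere are harmless, since complements of interior elements are interior.\<close>

definition complement_eigenvalue :: "'l::lattice \<Rightarrow> 'l \<Rightarrow> complex \<Rightarrow> bool" where
  "complement_eigenvalue A B \<mu> \<longleftrightarrow> (\<exists>g. (\<exists>x. A < x \<and> x < B \<and> g x \<noteq> 0) \<and>
     (\<forall>x. A < x \<longrightarrow> x < B \<longrightarrow> complement_sum A B g x = \<mu> * g x))"

definition flags :: "'l::lattice \<Rightarrow> 'l \<Rightarrow> ('l \<times> 'l) set" where
  "flags A B = {(x, y). A < x \<and> x < y \<and> y < B}"

text \<open>The operator \<open>P\<close> of the overview; \<open>upper\<close> is \<open>Q\<close>.
  Vectors indexed by all pairs and set to 0 off the flags put every interval of the lattice into one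
  space \<open>complex ^ ('l \<times> 'l)\<close>.\<close>

definition lower :: "'l::{lattice,finite} \<Rightarrow> 'l \<Rightarrow> complex ^ ('l \<times> 'l) \<Rightarrow> complex ^ ('l \<times> 'l)" where
  "lower A B f = (\<chi> p. if p \<in> flags A B
     then \<Sum>u\<in>complements A (snd p) (fst p). f $ (u, snd p) else 0)"

definition upper :: "'l::{lattice,finite} \<Rightarrow> 'l \<Rightarrow> complex ^ ('l \<times> 'l) \<Rightarrow> complex ^ ('l \<times> 'l)" where
  "upper A B f = (\<chi> p. if p \<in> flags A B
     then \<Sum>w\<in>complements (fst p) B (snd p). f $ (fst p, w) else 0)"

definition flag_functions :: "'l::{lattice,finite} \<Rightarrow> 'l \<Rightarrow> (complex ^ ('l \<times> 'l)) set" where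
  "flag_functions A B = {f. \<forall>p. p \<notin> flags A B \<longrightarrow> f $ p = 0}"

lemma linear_lower: "Vector_Spaces.linear (*s) (*s) (lower A B)"
  by unfold_locales (auto simp: lower_def Finite_Cartesian_Product.vec_eq_iff sum.distrib sum_distrib_left algebra_simps)

lemma linear_upper: "Vector_Spaces.linear (*s) (*s) (upper A B)"
  by unfold_locales (auto simp: upper_def Finite_Cartesian_Product.vec_eq_iff sum.distrib sum_distrib_left algebra_simps)

lemma subspace_flag_functions: "vec.subspace (flag_functions A B)"
  by (auto simp: flag_functions_def vec.subspace_def)

lemma lower_in: "lower A B f \<in> flag_functions A B"
  by (simp add: flag_functions_def lower_def)

lemma upper_in: "upper A B f \<in> flag_functions A B"
  by (simp add: flag_functions_def upper_def)

lemma lower_at: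
  "A < x \<Longrightarrow> x < y \<Longrightarrow> y < B \<Longrightarrow> lower A B f $ (x, y) = (\<Sum>u\<in>complements A y x. f $ (u, y))"
  by (simp add: lower_def flags_def)

lemma upper_at:
  "A < x \<Longrightarrow> x < y \<Longrightarrow> y < B \<Longrightarrow> upper A B f $ (x, y) = (\<Sum>w\<in>complements x B y. f $ (x, w))"
  by (simp add: upper_def flags_def)

lemma flag_functions_eqI:
  assumes "f \<in> flag_functions A B" "g \<in> flag_functions A B"
    and "\<And>x y. A < x \<Longrightarrow> x < y \<Longrightarrow> y < B \<Longrightarrow> f $ (x, y) = g $ (x, y)"
  shows "f = g"
proof (intro Finite_Cartesian_Product.vec_eq_iff[THEN iffD2] allI)
  fix p show "f $ p = g $ p"
    using assms by (cases "p \<in> flags A B"; cases p) (auto simp: flag_functions_def flags_def)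
qed

section \<open>The modular law and the braid relation\<close>

lemma sup_inf_modular:
  fixes x y z :: "'l::modular_lattice"
  assumes "x \<le> z" "inf y z = A" "A \<le> x" shows "inf z (sup x y) = x"
  using modular[OF assms(1), of y] assms by (simp add: inf_commute sup_absorb1)

lemma inf_sup_modular:
  fixes x y z :: "'l::modular_lattice"
  assumes "x \<le> z" "sup x y = B" "z \<le> B" shows "sup x (inf z y) = z"
  using modular[OF assms(1), of y] assms by (simp add: inf_commute inf_absorb1 inf_absorb2)

text \<open>Opposition of flags as in the building of subspaces. For x < y the modular law excludes
  a common complement of both, so \<open>t \<le> w\<close> is then strict.\<close>

definition opposite_flags :: "'l::lattice \<Rightarrow> 'l \<Rightarrow> 'l \<Rightarrow> 'l \<Rightarrow> ('l \<times> 'l) set" where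
  "opposite_flags A B x y = {(t, w). t \<le> w \<and> w \<in> complements A B x \<and> t \<in> complements A B y}"

text \<open>Both sides of the braid relation sum over the flags opposite to a given one, because the
  intermediate flags of such a walk of length three are determined by its two ends.\<close>

lemma lower_upper_lower_at:
  fixes A B :: "'l::{modular_lattice,finite}"
  assumes xy: "A < x" "x < y" "y < B"
  shows "lower A B (upper A B (lower A B f)) $ (x, y) = (\<Sum>p\<in>opposite_flags A B x y. f $ p)"
proof -
  have "lower A B (upper A B (lower A B f)) $ (x, y) =
      (\<Sum>u\<in>complements A y x. \<Sum>w\<in>complements u B y. \<Sum>t\<in>complements A w u. f $ (t, w))"
    unfolding lower_at[OF xy]
  proof (intro sum.cong refl)
    fix u assume "u \<in> complements A y x"
    then have u: "A < u" "u < y" using complements_strict xy by blast+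
    show "upper A B (lower A B f) $ (u, y) =
        (\<Sum>w\<in>complements u B y. \<Sum>t\<in>complements A w u. f $ (t, w))"
      unfolding upper_at[OF u xy(3)]
      using complements_strict[of _ u B y] u xy by (intro sum.cong refl lower_at) auto
  qed
  also have "\<dots> = (\<Sum>(u, w, t)\<in>(SIGMA u:complements A y x. SIGMA w:complements u B y. complements A w u).
      f $ (t, w))"
    by (simp add: sum.Sigma)
  also have "\<dots> = (\<Sum>p\<in>opposite_flags A B x y. f $ p)"
  \<comment> \<open>The walk is (x,y), (u,y), (u,w), (t,w), and its only inner unknown is u = inf y
    w.\<close>
  proof (rule sum.reindex_bij_witness[where i = "\<lambda>(t, w). (inf y w, w, t)" and j = "\<lambda>(u, w, t). (t, w)"])
    fix a assume "a \<in> (SIGMA u:complements A y x. SIGMA w:complements u B y. complements A w u)"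
    then obtain u w t where a: "a = (u, w, t)" and
      u: "inf x u = A" "sup x u = y" and w: "inf y w = u" "sup y w = B" and
      t: "inf u t = A" "sup u t = w"
      by (auto simp: complements_def)
    have le: "x \<le> y" "u \<le> w" "u \<le> y" "t \<le> w" using u w t xy by auto
    have "inf x w = A" using u(1) w(1) le(1) by (metis inf.absorb1 inf.assoc)
    moreover have "sup x w = B" using u(2) w(2) le(2) by (metis sup.absorb2 sup.assoc)
    moreover have "inf y t = A" using w(1) t(1) le(4) by (metis inf.absorb2 inf.assoc)
    moreover have "sup y t = B" using w(2) t(2) le(3) by (metis sup.absorb1 sup.assoc)
    ultimately show "(case a of (u, w, t) \<Rightarrow> (t, w)) \<in> opposite_flags A B x y"
      using a le by (simp add: opposite_flags_def complements_def)
    show "(case (case a of (u, w, t) \<Rightarrow> (t, w)) of (t, w) \<Rightarrow> (inf y w, w, t)) = a"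
      using a w by simp
  next
    \<comment> \<open>Conversely, for an opposite flag the modular law makes \<open>inf y w\<close>
      a complement of \<open>x\<close> in [A, y] and of \<open>t\<close> in [A, w].\<close>
    fix b assume "b \<in> opposite_flags A B x y"
    then obtain t w where b: "b = (t, w)" and tw: "t \<le> w" and
      w: "inf x w = A" "sup x w = B" and t: "inf y t = A" "sup y t = B"
      by (auto simp: opposite_flags_def complements_def)
    have le: "x \<le> y" "y \<le> B" "w \<le> B" using xy w by auto
    have "inf x (inf y w) = A" using w(1) le(1) by (metis inf.absorb1 inf.assoc)
    moreover have "sup x (inf y w) = y" by (rule inf_sup_modular[OF le(1) w(2) le(2)])
    moreover have "sup y w = B" using t(2) tw le by (metis antisym sup.mono order_refl sup.bounded_iff)
    moreover have "inf (inf y w) t = A" using t(1) tw by (metis inf.absorb2 inf.assoc)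
    moreover have "sup (inf y w) t = w"
      using inf_sup_modular[OF tw _ le(3), of y] t(2) by (simp add: sup_commute inf_commute)
    ultimately show "(case b of (t, w) \<Rightarrow> (inf y w, w, t)) \<in>
        (SIGMA u:complements A y x. SIGMA w:complements u B y. complements A w u)"
      using b by (simp add: complements_def)
  qed (auto simp: case_prod_beta)
  finally show ?thesis .
qed

lemma upper_lower_upper_at:
  fixes A B :: "'l::{modular_lattice,finite}"
  assumes xy: "A < x" "x < y" "y < B"
  shows "upper A B (lower A B (upper A B f)) $ (x, y) = (\<Sum>p\<in>opposite_flags A B x y. f $ p)"
proof -
  have "upper A B (lower A B (upper A B f)) $ (x, y) =
      (\<Sum>v\<in>complements x B y. \<Sum>t\<in>complements A v x. \<Sum>w\<in>complements t B v. f $ (t, w))"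
    unfolding upper_at[OF xy]
  proof (intro sum.cong refl)
    fix v assume "v \<in> complements x B y"
    then have v: "x < v" "v < B" using complements_strict xy by blast+
    show "lower A B (upper A B f) $ (x, v) =
        (\<Sum>t\<in>complements A v x. \<Sum>w\<in>complements t B v. f $ (t, w))"
      unfolding lower_at[OF xy(1) v]
      using complements_strict[of _ A v x] v xy by (intro sum.cong refl upper_at) auto
  qed
  also have "\<dots> = (\<Sum>(v, t, w)\<in>(SIGMA v:complements x B y. SIGMA t:complements A v x. complements t B v).
      f $ (t, w))"
    by (simp add: sum.Sigma)
  also have "\<dots> = (\<Sum>p\<in>opposite_flags A B x y. f $ p)"
  \<comment> \<open>Here the walk is (x,y), (x,v), (t,v), (t,w), and the inner unknown is v = sup x
    t.\<close>
  proof (rule sum.reindex_bij_witness[where i = "\<lambda>(t, w). (sup x t, t, w)" and j = "\<lambda>(v, t, w). (t, w)"])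
    fix a assume "a \<in> (SIGMA v:complements x B y. SIGMA t:complements A v x. complements t B v)"
    then obtain v t w where a: "a = (v, t, w)" and
      v: "inf y v = x" "sup y v = B" and t: "inf x t = A" "sup x t = v" and
      w: "inf v w = t" "sup v w = B"
      by (auto simp: complements_def)
    have le: "x \<le> y" "x \<le> v" "t \<le> v" "t \<le> w" using v w t xy by auto
    have "inf x w = A" using t(1) w(1) le(2) by (metis inf.absorb1 inf.assoc)
    moreover have "sup x w = B" using t(2) w(2) le(4) by (metis sup.absorb2 sup.assoc)
    moreover have "inf y t = A" using v(1) t(1) le(3) by (metis inf.absorb2 inf.assoc)
    moreover have "sup y t = B" using v(2) t(2) le(1) by (metis sup.absorb1 sup.assoc)
    ultimately show "(case a of (v, t, w) \<Rightarrow> (t, w)) \<in> opposite_flags A B x y"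
      using a le by (simp add: opposite_flags_def complements_def)
    show "(case (case a of (v, t, w) \<Rightarrow> (t, w)) of (t, w) \<Rightarrow> (sup x t, t, w)) = a"
      using a t by simp
  next
    fix b assume "b \<in> opposite_flags A B x y"
    then obtain t w where b: "b = (t, w)" and tw: "t \<le> w" and
      w: "inf x w = A" "sup x w = B" and t: "inf y t = A" "sup y t = B"
      by (auto simp: opposite_flags_def complements_def)
    have le: "x \<le> y" "A \<le> x" "A \<le> t" using xy t by auto
    have "inf y (sup x t) = x" using t(1) le by (intro sup_inf_modular[of x y t A]) (auto simp: inf_commute)
    moreover have "sup y (sup x t) = B" using t(2) le(1) by (metis sup.absorb1 sup.assoc)
    moreover have "inf x t = A" using t(1) le by (metis antisym inf.mono order_refl inf.bounded_iff)
    moreover have "inf (sup x t) w = t"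
      using sup_inf_modular[OF tw w(1) le(3)] by (simp add: sup_commute inf_commute)
    moreover have "sup (sup x t) w = B" using w(2) tw by (metis sup.absorb2 sup.assoc)
    ultimately show "(case b of (t, w) \<Rightarrow> (sup x t, t, w)) \<in>
        (SIGMA v:complements x B y. SIGMA t:complements A v x. complements t B v)"
      using b by (simp add: complements_def)
  qed (auto simp: case_prod_beta)
  finally show ?thesis .
qed

lemma lower_upper_braid:
  fixes A B :: "'l::{modular_lattice,finite}"
  shows "lower A B (upper A B (lower A B f)) = upper A B (lower A B (upper A B f))"
  by (rule flag_functions_eqI[OF lower_in upper_in])
    (simp add: lower_upper_lower_at upper_lower_upper_at)

section \<open>Functions of a single member of the flag\<close>

definition lift_fst :: "'l::{lattice,finite} \<Rightarrow> 'l \<Rightarrow> ('l \<Rightarrow> complex) \<Rightarrow> complex ^ ('l \<times> 'l)" where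
  "lift_fst A B g = (\<chi> p. if p \<in> flags A B then g (fst p) else 0)"

definition lift_snd :: "'l::{lattice,finite} \<Rightarrow> 'l \<Rightarrow> ('l \<Rightarrow> complex) \<Rightarrow> complex ^ ('l \<times> 'l)" where
  "lift_snd A B g = (\<chi> p. if p \<in> flags A B then g (snd p) else 0)"

lemma lift_in: "lift_fst A B g \<in> flag_functions A B" "lift_snd A B g \<in> flag_functions A B"
  by (auto simp: lift_fst_def lift_snd_def flag_functions_def)

text \<open>A walk (x,y), (x,w), (u,w) ends in a complement \<open>u\<close> of \<open>y\<close> in
  [A, B], and w = sup x u is recovered from it. Each complement is thus reached exactly once,
  whatever \<open>x\<close> is.\<close>

lemma upper_lower_lift_fst:
  fixes A B :: "'l::{modular_lattice,finite}"
  shows "upper A B (lower A B (lift_fst A B g)) = lift_snd A B (complement_sum A B g)"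
proof (rule flag_functions_eqI[OF upper_in lift_in(2)])
  fix x y assume xy: "A < x" "x < y" "y < B"
  have "upper A B (lower A B (lift_fst A B g)) $ (x, y) =
      (\<Sum>w\<in>complements x B y. \<Sum>u\<in>complements A w x. g u)"
    unfolding upper_at[OF xy]
  proof (intro sum.cong refl)
    fix w assume "w \<in> complements x B y"
    then have w: "x < w" "w < B" using complements_strict xy by blast+
    show "lower A B (lift_fst A B g) $ (x, w) = (\<Sum>u\<in>complements A w x. g u)"
      unfolding lower_at[OF xy(1) w]
      using complements_strict[of _ A w x] w xy
      by (intro sum.cong refl) (auto simp: lift_fst_def flags_def)
  qed
  also have "\<dots> = (\<Sum>(w, u)\<in>(SIGMA w:complements x B y. complements A w x). g u)"
    by (simp add: sum.Sigma)
  also have "\<dots> = (\<Sum>u\<in>complements A B y. g u)"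
  proof (rule sum.reindex_bij_witness[where i = "\<lambda>u. (sup x u, u)" and j = snd])
    fix a assume "a \<in> (SIGMA w:complements x B y. complements A w x)"
    then obtain w u where a: "a = (w, u)" and
      w: "inf y w = x" "sup y w = B" and u: "inf x u = A" "sup x u = w"
      by (auto simp: complements_def)
    have le: "x \<le> y" "u \<le> w" using xy sup_ge2[of u x] u(2) by auto
    have "inf y u = A" using w(1) u(1) le(2) by (metis inf.absorb2 inf.assoc)
    moreover have "sup y u = B" using w(2) u(2) le(1) by (metis sup.absorb1 sup.assoc)
    ultimately show "snd a \<in> complements A B y" using a by (simp add: complements_def)
    show "(sup x (snd a), snd a) = a" using a u by simp
  next
    fix u assume "u \<in> complements A B y"
    then have u: "inf y u = A" "sup y u = B" by (auto simp: complements_def)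
    have le: "x \<le> y" "A \<le> x" "A \<le> u" using xy u by auto
    have "inf y (sup x u) = x" using u(1) le by (intro sup_inf_modular[of x y u A]) (auto simp: inf_commute)
    moreover have "sup y (sup x u) = B" using u(2) le(1) by (metis sup.absorb1 sup.assoc)
    moreover have "inf x u = A" using u(1) le by (metis antisym inf.mono order_refl inf.bounded_iff)
    ultimately show "(sup x u, u) \<in> (SIGMA w:complements x B y. complements A w x)"
      by (simp add: complements_def)
  qed auto
  finally show "upper A B (lower A B (lift_fst A B g)) $ (x, y) =
      lift_snd A B (complement_sum A B g) $ (x, y)"
    using xy by (simp add: lift_snd_def flags_def complement_sum_def)
qed

text \<open>The dual count: a complement \<open>w\<close> of \<open>x\<close> determines the
  intermediate element u = inf y w.\<close>

lemma lower_upper_lift_snd: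
  fixes A B :: "'l::{modular_lattice,finite}"
  shows "lower A B (upper A B (lift_snd A B g)) = lift_fst A B (complement_sum A B g)"
proof (rule flag_functions_eqI[OF lower_in lift_in(1)])
  fix x y assume xy: "A < x" "x < y" "y < B"
  have "lower A B (upper A B (lift_snd A B g)) $ (x, y) =
      (\<Sum>u\<in>complements A y x. \<Sum>w\<in>complements u B y. g w)"
    unfolding lower_at[OF xy]
  proof (intro sum.cong refl)
    fix u assume "u \<in> complements A y x"
    then have u: "A < u" "u < y" using complements_strict xy by blast+
    show "upper A B (lift_snd A B g) $ (u, y) = (\<Sum>w\<in>complements u B y. g w)"
      unfolding upper_at[OF u xy(3)]
      using complements_strict[of _ u B y] u xy
      by (intro sum.cong refl) (auto simp: lift_snd_def flags_def)
  qed
  also have "\<dots> = (\<Sum>(u, w)\<in>(SIGMA u:complements A y x. complements u B y). g w)"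
    by (simp add: sum.Sigma)
  also have "\<dots> = (\<Sum>w\<in>complements A B x. g w)"
  proof (rule sum.reindex_bij_witness[where i = "\<lambda>w. (inf y w, w)" and j = snd])
    fix a assume "a \<in> (SIGMA u:complements A y x. complements u B y)"
    then obtain u w where a: "a = (u, w)" and
      u: "inf x u = A" "sup x u = y" and w: "inf y w = u" "sup y w = B"
      by (auto simp: complements_def)
    have le: "x \<le> y" "u \<le> w" using w u xy by auto
    have "inf x w = A" using u(1) w(1) le(1) by (metis inf.absorb1 inf.assoc)
    moreover have "sup x w = B" using u(2) w(2) le(2) by (metis sup.absorb2 sup.assoc)
    ultimately show "snd a \<in> complements A B x" using a by (simp add: complements_def)
    show "(inf y (snd a), snd a) = a" using a w by simp
  next
    fix w assume "w \<in> complements A B x"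
    then have w: "inf x w = A" "sup x w = B" by (auto simp: complements_def)
    have le: "x \<le> y" "y \<le> B" "w \<le> B" using xy w by auto
    have "inf x (inf y w) = A" using w(1) le(1) by (metis inf.absorb1 inf.assoc)
    moreover have "sup x (inf y w) = y" by (rule inf_sup_modular[OF le(1) w(2) le(2)])
    moreover have "sup y w = B" using w(2) le by (metis antisym sup.mono order_refl sup.bounded_iff)
    ultimately show "(inf y w, w) \<in> (SIGMA u:complements A y x. complements u B y)"
      by (simp add: complements_def)
  qed auto
  finally show "lower A B (upper A B (lift_snd A B g)) $ (x, y) =
      lift_fst A B (complement_sum A B g) $ (x, y)"
    using xy by (simp add: lift_fst_def flags_def complement_sum_def)
qed


section \<open>Eigenvalues of the complement relation\<close>

text \<open>\<open>lower\<close> leaves \<open>y\<close> fixed, so it splits into the complement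
  operators of the intervals [A, y]. A \<open>y\<close> for which \<open>f\<close> is not
  identically zero supplies the eigenfunction.\<close>

lemma complement_eigenvalue_of_lower:
  fixes A B :: "'l::{modular_lattice,finite}"
  assumes f: "f \<in> flag_functions A B" "f \<noteq> 0" "lower A B f = \<mu> *s f"
  shows "\<exists>y<B. A < y \<and> complement_eigenvalue A y \<mu>"
proof -
  obtain x y where xy: "A < x" "x < y" "y < B" "f $ (x, y) \<noteq> 0"
    using flag_functions_eqI[OF f(1), of 0] f(2) by (auto simp: flag_functions_def)
  have "complement_eigenvalue A y \<mu>"
    unfolding complement_eigenvalue_def
  proof (intro exI[of _ "\<lambda>u. f $ (u, y)"] conjI exI[of _ x] allI impI)
    fix u assume u: "A < u" "u < y"
    show "complement_sum A y (\<lambda>u. f $ (u, y)) u = \<mu> * f $ (u, y)"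
      using lower_at[OF u xy(3), of f] f(3) by (simp add: complement_sum_def)
  qed (use xy in auto)
  moreover have "A < y" using xy by (rule_tac less_trans)
  ultimately show ?thesis using xy(3) by blast
qed

lemma complement_eigenvalue_of_upper:
  fixes A B :: "'l::{modular_lattice,finite}"
  assumes f: "f \<in> flag_functions A B" "f \<noteq> 0" "upper A B f = \<mu> *s f"
  shows "\<exists>x>A. x < B \<and> complement_eigenvalue x B \<mu>"
proof -
  obtain x y where xy: "A < x" "x < y" "y < B" "f $ (x, y) \<noteq> 0"
    using flag_functions_eqI[OF f(1), of 0] f(2) by (auto simp: flag_functions_def)
  have "complement_eigenvalue x B \<mu>"
    unfolding complement_eigenvalue_def
  proof (intro exI[of _ "\<lambda>u. f $ (x, u)"] conjI exI[of _ y] allI impI)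
    fix u assume u: "x < u" "u < B"
    show "complement_sum x B (\<lambda>u. f $ (x, u)) u = \<mu> * f $ (x, u)"
      using upper_at[OF xy(1) u, of f] f(3) by (simp add: complement_sum_def)
  qed (use xy in auto)
  moreover have "x < B" using xy(2,3) by (rule less_trans)
  ultimately show ?thesis using xy(1) by blast
qed

text \<open>The place where knowledge about the shorter intervals [A, y] and [x, B] enters: it
  supplies the eigenvalue conditions.\<close>

lemma braid_pair_lower_upper:
  fixes A B :: "'l::{modular_lattice,finite}"
  assumes q: "q > 0"
    and below: "\<And>y \<mu>. A < y \<Longrightarrow> y < B \<Longrightarrow> complement_eigenvalue A y \<mu> \<Longrightarrow> pure_power q \<mu>"
    and above: "\<And>x \<mu>. A < x \<Longrightarrow> x < B \<Longrightarrow> complement_eigenvalue x B \<mu> \<Longrightarrow> pure_power q \<mu>"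
  shows "braid_pair q (flag_functions A B) (lower A B) (upper A B)"
proof (rule braid_pair.intro[OF q subspace_flag_functions linear_lower linear_upper
      lower_in upper_in lower_upper_braid])
  fix f \<mu> assume f: "f \<in> flag_functions A B" "f \<noteq> 0"
  show "pure_power q \<mu>" if "lower A B f = \<mu> *s f"
    using complement_eigenvalue_of_lower[OF f that] below by blast
  show "pure_power q \<mu>" if "upper A B f = \<mu> *s f"
    using complement_eigenvalue_of_upper[OF f that] above by blast
qed

section \<open>Intervals of length two\<close>

lemma inf_less_left_iff: "inf x u < x \<longleftrightarrow> \<not> x \<le> u" for x u :: "'l::lattice"
  by (metis less_le inf_le1 inf.absorb_iff1)

lemma less_sup_left_iff: "x < sup x u \<longleftrightarrow> \<not> u \<le> x" for x u :: "'l::lattice"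
  by (metis less_le sup_ge1 sup.absorb_iff1)

text \<open>One element \<open>y\<close> that covers \<open>A\<close> and is covered by
  \<open>B\<close> forces, by modularity, the whole open interval to be an antichain; distinct
  elements of it are then complementary.\<close>

lemma complements_atom_coatom:
  fixes A B y :: "'l::modular_lattice"
  assumes y: "A < y" "y < B" and atom: "\<And>x. A < x \<Longrightarrow> \<not> x < y" and coatom: "\<And>z. y < z \<Longrightarrow> \<not> z < B"
    and x: "A < x" "x < B"
  shows "complements A B x = {A<..<B} - {x}"
proof -
  have compl_y: "inf y w = A \<and> sup y w = B" if w: "A < w" "w < B" "w \<noteq> y" for w
  proof -
    have "\<not> y \<le> w" "\<not> w \<le> y" using coatom atom w by (auto simp: le_less)
    then have "inf y w < y" "y < sup y w"
      by (simp_all add: inf_less_left_iff less_sup_left_iff)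
    moreover have "A \<le> inf y w" "sup y w \<le> B" using w y by auto
    ultimately have "inf y w = A" "sup y w = B"
      using atom[of "inf y w"] coatom[of "sup y w"] by (auto simp: le_less)
    then show ?thesis by simp
  qed
  \<comment> \<open>Any element other than \<open>y\<close> is a complement of \<open>y\<close>, and
    two comparable complements of \<open>y\<close> coincide by the modular law.\<close>
  have antichain: "\<not> u < w" if u: "A < u" "u < B" and w: "A < w" "w < B" for u w
  proof
    assume "u < w"
    consider "u = y" | "w = y" | "u \<noteq> y" "w \<noteq> y" by blast
    then show False
    proof cases
      case 3
      have "sup u (inf y w) = inf (sup u y) w"
        using \<open>u < w\<close> by (intro modular) simp
      moreover have "inf y w = A" "sup u y = B"
        using compl_y[OF u 3(1)] compl_y[OF w 3(2)] by (simp_all add: sup_commute)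
      ultimately have "u = w" using u w by (simp add: sup_absorb1 inf_absorb2 less_imp_le)
      then show False using \<open>u < w\<close> by simp
    next
      case 1
      then show False using coatom[of w] \<open>u < w\<close> w by simp
    next
      case 2
      then show False using atom[of u] \<open>u < w\<close> u by simp
    qed
  qed
  show ?thesis
  proof (intro equalityI subsetI)
    fix u assume u: "u \<in> complements A B x"
    then have "u \<noteq> x" using x by (auto simp: complements_def)
    then show "u \<in> {A<..<B} - {x}" using complements_strict[OF u x] by simp
  next
    fix u assume u: "u \<in> {A<..<B} - {x}"
    then have u: "A < u" "u < B" "u \<noteq> x" by auto
    have "\<not> x \<le> u" "\<not> u \<le> x" using antichain u x by (auto simp: le_less)
    then have "inf x u < x" "x < sup x u"
      by (simp_all add: inf_less_left_iff less_sup_left_iff)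
    moreover have "A \<le> inf x u" "sup x u \<le> B" using u x by auto
    \<comment> \<open>The meet lies strictly below \<open>x\<close> and the join strictly above it;
      neither can be interior to an antichain containing \<open>x\<close>.\<close>
    ultimately have "inf x u = A" "sup x u = B"
      using antichain[of "inf x u" x] antichain[of x "sup x u"] x
      by (auto simp: le_less dest: order.strict_trans)
    then show "u \<in> complements A B x" by (simp add: complements_def)
  qed
qed

text \<open>Here S = J - I with J the all-ones operator, so the eigenvalue depends on whether the
  sum of the eigenfunction vanishes.\<close>

lemma complement_eigenvalue_atom_coatom:
  fixes A B y :: "'l::{modular_lattice,finite}"
  assumes y: "A < y" "y < B" and atom: "\<And>x. A < x \<Longrightarrow> \<not> x < y" and coatom: "\<And>z. y < z \<Longrightarrow> \<not> z < B"
    and \<mu>: "complement_eigenvalue A B \<mu>"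
  shows "\<mu> = -1 \<or> \<mu> = of_nat (card {A<..<B}) - 1"
proof -
  obtain g x where g: "A < x" "x < B" "g x \<noteq> 0"
      "\<And>x. A < x \<Longrightarrow> x < B \<Longrightarrow> complement_sum A B g x = \<mu> * g x"
    using \<mu> by (auto simp: complement_eigenvalue_def)
  define s where "s = (\<Sum>u\<in>{A<..<B}. g u)"
  have eq: "s - g w = \<mu> * g w" if "w \<in> {A<..<B}" for w
    using g(4)[of w] complements_atom_coatom[OF y atom coatom, of w] that
    by (simp add: complement_sum_def sum_diff1 s_def)
  \<comment> \<open>Summing the eigenvalue equation over the interval of N elements gives (N - 1) s
    = \<mu> s.\<close>
  have "(\<Sum>w\<in>{A<..<B}. s - g w) = (\<Sum>w\<in>{A<..<B}. \<mu> * g w)"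
    using eq by (intro sum.cong) auto
  then have "of_nat (card {A<..<B}) * s - s = \<mu> * s"
    by (simp add: sum_subtractf s_def flip: sum_distrib_left)
  then have "s = 0 \<or> \<mu> = of_nat (card {A<..<B}) - 1"
  proof -
    have "(of_nat (card {A<..<B}) - 1 - \<mu>) * s = 0"
      using \<open>of_nat (card {A<..<B}) * s - s = \<mu> * s\<close> by (simp add: left_diff_distrib)
    then show ?thesis by auto
  qed
  moreover have "\<mu> = -1" if "s = 0"
  proof -
    have "\<mu> * g x = - g x" using eq[of x] g(1,2) that by simp
    then have "(\<mu> + 1) * g x = 0" by (simp add: distrib_right)
    then show ?thesis using g(3) by (simp add: add_eq_0_iff2)
  qed
  ultimately show ?thesis by blast
qed

text \<open>The number of elements of [A, B] serves as induction measure in place of a rank. Lifted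
  to flags, an eigenfunction of \<open>S\<close> becomes an eigenvector for \<mu>^2, provided that
  some flag makes the lift nonzero.\<close>

theorem complement_eigenvalue_pure_power:
  fixes A B :: "'l::{modular_lattice,finite}"
  assumes q: "q > 0"
    and length_2: "\<And>A y B :: 'l. A < y \<Longrightarrow> y < B \<Longrightarrow> (\<And>x. A < x \<Longrightarrow> \<not> x < y) \<Longrightarrow>
      (\<And>z. y < z \<Longrightarrow> \<not> z < B) \<Longrightarrow> card {A<..<B} = q + 1"
  shows "complement_eigenvalue A B \<mu> \<Longrightarrow> pure_power q \<mu>"
proof (induction "card {A..B}" arbitrary: A B \<mu> rule: less_induct)
  case less
  obtain g y where g: "A < y" "y < B" "g y \<noteq> 0"
      "\<And>x. A < x \<Longrightarrow> x < B \<Longrightarrow> complement_sum A B g x = \<mu> * g x"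
    using less.prems by (auto simp: complement_eigenvalue_def)
  have "A < B" using g(1,2) by (rule less_trans)
  have "braid_pair q (flag_functions A B) (lower A B) (upper A B)"
  proof (rule braid_pair_lower_upper[OF q])
    fix w \<nu> assume w: "A < w" "w < B"
    have "{A..w} \<subset> {A..B}" and "{w..B} \<subset> {A..B}"
      using w \<open>A < B\<close> by (auto intro: order.trans less_imp_le dest: order.strict_trans2)
    then have "card {A..w} < card {A..B}" "card {w..B} < card {A..B}"
      by (auto intro: psubset_card_mono)
    then show "complement_eigenvalue A w \<nu> \<Longrightarrow> pure_power q \<nu>"
      and "complement_eigenvalue w B \<nu> \<Longrightarrow> pure_power q \<nu>"
      using less.hyps by blast+
  qed
  note bp = this braid_pair.swap[OF this]
  \<comment> \<open>The eigenvalue equation holds only inside the interval, so the second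
    application of \<open>S\<close> uses that complements stay inside.\<close>
  have sum_sum: "complement_sum A B (complement_sum A B g) x = \<mu>\<^sup>2 * g x" if x: "A < x" "x < B" for x
  proof -
    have "complement_sum A B (complement_sum A B g) x = (\<Sum>u\<in>complements A B x. \<mu> * g u)"
      unfolding complement_sum_def[of A B "complement_sum A B g"]
      using complements_strict[OF _ x] by (intro sum.cong refl g(4)) auto
    also have "\<dots> = \<mu> * complement_sum A B g x" by (simp add: complement_sum_def sum_distrib_left)
    finally show ?thesis using g(4)[OF x] by (simp add: power2_eq_square)
  qed
  \<comment> \<open>The split is made at a point \<open>y\<close> with g y \<noteq> 0. An element
    below or above it gives a flag on which a lift of \<open>g\<close> is nonzero; otherwise the
    interval has length two.\<close>
  consider (below) x where "A < x" "x < y" | (above) z where "y < z" "z < B"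
    | (neither) "\<And>x. A < x \<Longrightarrow> \<not> x < y" "\<And>z. y < z \<Longrightarrow> \<not> z < B"
    by blast
  then show ?case
  proof cases
    case below
    \<comment> \<open>The inner pair turns a function of \<open>y\<close> into \<open>S\<close> of
      it as a function of \<open>x\<close>; the outer pair applies \<open>S\<close> again and
      returns to functions of \<open>y\<close>.\<close>
    have eq: "upper A B (lower A B (lower A B (upper A B (lift_snd A B g)))) = \<mu>\<^sup>2 *s lift_snd A B g"
      unfolding lower_upper_lift_snd upper_lower_lift_fst using sum_sum
      by (rule_tac flag_functions_eqI[OF lift_in(2) vec.subspace_scale[OF subspace_flag_functions lift_in(2)]])
        (auto simp: lift_snd_def flags_def dest: order.strict_trans)
    have "lift_snd A B g $ (x, y) \<noteq> 0" using below g by (simp add: lift_snd_def flags_def)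
    then have "lift_snd A B g \<noteq> 0" by auto
    with eq have "pure_power q (\<mu>\<^sup>2)"
      using braid_pair.pure_power_QPPQ[OF bp(1) lift_in(2)] by blast
    then show ?thesis by (rule pure_power_root) simp
  next
    case above
    \<comment> \<open>The mirror image PQQP, treated by the braid pair with its two operators
      exchanged.\<close>
    have eq: "lower A B (upper A B (upper A B (lower A B (lift_fst A B g)))) = \<mu>\<^sup>2 *s lift_fst A B g"
      unfolding lower_upper_lift_snd upper_lower_lift_fst using sum_sum
      by (rule_tac flag_functions_eqI[OF lift_in(1) vec.subspace_scale[OF subspace_flag_functions lift_in(1)]])
        (auto simp: lift_fst_def flags_def dest: order.strict_trans)
    have "lift_fst A B g $ (y, z) \<noteq> 0" using above g by (simp add: lift_fst_def flags_def)
    then have "lift_fst A B g \<noteq> 0" by auto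
    with eq have "pure_power q (\<mu>\<^sup>2)"
      using braid_pair.pure_power_QPPQ[OF bp(2) lift_in(1)] by blast
    then show ?thesis by (rule pure_power_root) simp
  next
    case neither
    then show ?thesis
      using complement_eigenvalue_atom_coatom[OF g(1,2) _ _ less.prems] length_2[OF g(1,2)]
      by (metis add_diff_cancel_right' of_nat_1 of_nat_add pure_power_minus_1 pure_power_of_nat)
  qed
qed

text \<open>Walks alternate between increasing and decreasing flags, so six steps give a full twist.\<close>

lemma pure_power_alternating:
  fixes A B :: "'l::{modular_lattice,finite}"
  assumes bp: "braid_pair q (flag_functions A B) (lower A B) (upper A B)"
    and f: "f \<in> flag_functions A B" "h \<in> flag_functions A B" "f \<noteq> 0 \<or> h \<noteq> 0"
    and eq: "lower A B h = \<mu> *s f" "upper A B f = \<mu> *s h"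
    and "\<mu> \<noteq> 0"
  shows "pure_power q \<mu>"
proof -
  interpret P: Vector_Spaces.linear "(*s)" "(*s)" "lower A B" by (rule linear_lower)
  interpret Q: Vector_Spaces.linear "(*s)" "(*s)" "upper A B" by (rule linear_upper)
  have "h \<noteq> 0"
  proof
    assume "h = 0"
    then have "\<mu> *s f = 0" using eq(1) P.zero by simp
    then show False using f(3) \<open>\<mu> \<noteq> 0\<close> \<open>h = 0\<close> by simp
  qed
  moreover have "upper A B (lower A B (upper A B (lower A B (upper A B (lower A B h))))) = \<mu> ^ 6 *s h"
    by (simp add: eq P.scale Q.scale eval_nat_numeral mult_ac)
  ultimately have "pure_power q (\<mu> ^ 6)"
    using braid_pair.pure_power_full_twist[OF bp f(2)] by blast
  then show ?thesis by (rule pure_power_root) simp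
qed


section \<open>The lattice of subspaces\<close>

text \<open>A type of subspaces, so that lattice and finiteness become class instances and pairs of
  subspaces can index vectors.\<close>

typedef (overloaded) ('a, 'n) subspace = "{W :: ('a::field ^ 'n::finite) set. vec.subspace W}"
  by (rule exI[of _ UNIV]) (simp add: vec.subspace_UNIV)

lemma subspace_Rep [simp]: "vec.subspace (Rep_subspace W)"
  using Rep_subspace by simp

instance subspace :: ("{field,finite}", finite) finite
proof
  have "inj Rep_subspace" by (simp add: inj_on_def Rep_subspace_inject)
  then show "finite (UNIV :: ('a, 'b) subspace set)"
    by (rule finite_imageD[OF finite_subset[OF subset_UNIV finite]])
qed

instantiation subspace :: (field, finite) modular_lattice
begin

definition "W \<le> U \<longleftrightarrow> Rep_subspace W \<subseteq> Rep_subspace U"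
definition "W < U \<longleftrightarrow> Rep_subspace W \<subset> Rep_subspace U"
definition "inf W U = Abs_subspace (Rep_subspace W \<inter> Rep_subspace U)"
definition "sup W U = Abs_subspace (Rep_subspace W + Rep_subspace U)"

lemma Rep_inf: "Rep_subspace (inf W U) = Rep_subspace W \<inter> Rep_subspace U"
  by (simp add: inf_subspace_def Abs_subspace_inverse vec.subspace_inter)

lemma Rep_sup: "Rep_subspace (sup W U) = Rep_subspace W + Rep_subspace U"
proof -
  have "vec.subspace (Rep_subspace W + Rep_subspace U)"
    using vec.subspace_sums[OF subspace_Rep subspace_Rep, of W U]
    by (simp add: set_plus_def Bex_def conj_commute conj_left_commute cong: conj_cong)
  then show ?thesis by (simp add: sup_subspace_def Abs_subspace_inverse)
qed

lemma subset_sum_left: "Rep_subspace W \<subseteq> Rep_subspace W + Rep_subspace U"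
  using vec.subspace_0[OF subspace_Rep[of U]] by (force simp: set_plus_def)

lemma subset_sum_right: "Rep_subspace U \<subseteq> Rep_subspace W + Rep_subspace U"
  using vec.subspace_0[OF subspace_Rep[of W]] by (force simp: set_plus_def)

instance
proof
  fix x y z :: "('a, 'b) subspace"
  show "(x < y) = (x \<le> y \<and> \<not> y \<le> x)" by (auto simp: less_eq_subspace_def less_subspace_def)
  show "x \<le> x" "x \<le> y \<Longrightarrow> y \<le> z \<Longrightarrow> x \<le> z" by (auto simp: less_eq_subspace_def)
  show "x \<le> y \<Longrightarrow> y \<le> x \<Longrightarrow> x = y" by (simp add: less_eq_subspace_def flip: Rep_subspace_inject)
  show "inf x y \<le> x" "inf x y \<le> y" "x \<le> y \<Longrightarrow> x \<le> z \<Longrightarrow> x \<le> inf y z"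
    by (auto simp: less_eq_subspace_def Rep_inf)
  show "x \<le> sup x y" "y \<le> sup x y"
    by (simp_all add: less_eq_subspace_def Rep_sup subset_sum_left subset_sum_right)
  show "y \<le> x \<Longrightarrow> z \<le> x \<Longrightarrow> sup y z \<le> x"
    using vec.subspace_add[OF subspace_Rep[of x]]
    by (auto simp: less_eq_subspace_def Rep_sup set_plus_def)
  show "sup x (inf y z) = inf (sup x y) z" if "x \<le> z"
  proof -
    \<comment> \<open>The modular law: if a + b lies in z and a lies in x, a part of z, then b lies
      in z.\<close>
    have "b \<in> Rep_subspace z" if "a \<in> Rep_subspace x" "a + b \<in> Rep_subspace z" for a b
      using vec.subspace_diff[OF subspace_Rep[of z] that(2), of a] that \<open>x \<le> z\<close>
      by (auto simp: less_eq_subspace_def)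
    moreover have "a + b \<in> Rep_subspace z" if "a \<in> Rep_subspace x" "b \<in> Rep_subspace z" for a b
      using vec.subspace_add[OF subspace_Rep[of z]] that \<open>x \<le> z\<close>
      by (auto simp: less_eq_subspace_def)
    ultimately have "Rep_subspace (sup x (inf y z)) = Rep_subspace (inf (sup x y) z)"
      by (auto simp: Rep_inf Rep_sup set_plus_def)
    then show ?thesis by (simp only: Rep_subspace_inject)
  qed
qed

end

section \<open>Counting vectors in subspaces over a finite field\<close>

definition adjoin :: "('a::field, 'n::finite) subspace \<Rightarrow> 'a ^ 'n \<Rightarrow> ('a, 'n) subspace" where
  "adjoin A v = sup A (Abs_subspace (vec.span {v}))"

lemma Rep_adjoin: "Rep_subspace (adjoin A v) = (\<lambda>(a, c). a + c *s v) ` (Rep_subspace A \<times> UNIV)"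
proof -
  have "Rep_subspace (adjoin A v) = Rep_subspace A + vec.span {v}"
    by (simp add: adjoin_def Rep_sup Abs_subspace_inverse)
  also have "\<dots> = (\<lambda>(a, c). a + c *s v) ` (Rep_subspace A \<times> UNIV)"
    by (auto simp: set_plus_def vec.span_singleton image_iff)
  finally show ?thesis .
qed

lemma adjoin_mem: "v \<in> Rep_subspace (adjoin A v)"
  unfolding Rep_adjoin using vec.subspace_0[OF subspace_Rep[of A]]
  by (intro image_eqI[of _ _ "(0, 1)"]) auto

lemma less_adjoin: "v \<notin> Rep_subspace A \<Longrightarrow> A < adjoin A v"
  using adjoin_mem[of v A] by (auto simp: less_le adjoin_def)

lemma adjoin_le: "A \<le> W \<Longrightarrow> v \<in> Rep_subspace W \<Longrightarrow> adjoin A v \<le> W"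
  unfolding adjoin_def
  by (simp add: less_eq_subspace_def[of "Abs_subspace _"] Abs_subspace_inverse
      vec.subspace_span vec.span_minimal)

text \<open>For any v in W outside A, the covering relation forces W = A + span {v}, and each vector
  of it is a + c v for exactly one pair (a, c).\<close>

lemma card_cover:
  fixes A W :: "('a::{field,finite}, 'n::finite) subspace"
  assumes "A < W" "\<And>U. A < U \<Longrightarrow> \<not> U < W"
  shows "card (Rep_subspace W) = CARD('a) * card (Rep_subspace A)"
proof -
  obtain v where v: "v \<in> Rep_subspace W" "v \<notin> Rep_subspace A"
    using assms(1) by (auto simp: less_subspace_def)
  have "inj_on (\<lambda>(a, c). a + c *s v) (Rep_subspace A \<times> UNIV)"
  proof (rule inj_onI, clarify)
    fix a c b d assume a: "a \<in> Rep_subspace A" "b \<in> Rep_subspace A" and eq: "a + c *s v = b + d *s v"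
    have "(c - d) *s v = b - a" using eq by (simp add: vec.scale_left_diff_distrib algebra_simps)
    then have "(c - d) *s v \<in> Rep_subspace A" using vec.subspace_diff[OF subspace_Rep] a by simp
    then have "inverse (c - d) *s ((c - d) *s v) \<in> Rep_subspace A"
      by (rule vec.subspace_scale[OF subspace_Rep])
    moreover have "inverse (c - d) *s ((c - d) *s v) = v" if "c \<noteq> d"
      unfolding vec.scale_scale using that by simp
    ultimately have "c = d" using v(2) by metis
    then show "a = b \<and> c = d" using eq by simp
  qed
  moreover have "W = adjoin A v"
    using adjoin_le[of A W v] less_adjoin[of v A] assms v by (auto simp: le_less)
  ultimately show ?thesis
    by (simp add: Rep_adjoin card_image card_cartesian_product)
qed

text \<open>The N middle subspaces have q |A| elements each, meet pairwise in A and cover B.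
  Counting the vectors of B outside A gives (q^2 - 1) |A| = N (q - 1) |A|.\<close>

lemma card_interval_length_2:
  fixes A B Y :: "('a::{field,finite}, 'n::finite) subspace"
  assumes Y: "A < Y" "Y < B" and atom: "\<And>X. A < X \<Longrightarrow> \<not> X < Y" and coatom: "\<And>Z. Y < Z \<Longrightarrow> \<not> Z < B"
  shows "card {A<..<B} = CARD('a) + 1"
proof -
  define q where "q = CARD('a)"
  define a where "a = card (Rep_subspace A)"
  have q: "q \<ge> 2"
    using card_mono[of "UNIV :: 'a set" "{0, 1}"] by (simp add: q_def)
  have a: "a > 0" unfolding a_def
    using vec.subspace_0[OF subspace_Rep[of A]] by (auto simp: card_gt_0_iff)
  have inf_eq: "inf X W = A" if "X \<in> {A<..<B}" "W \<in> {A<..<B}" "X \<noteq> W" for X W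
  proof -
    have X: "A < X" "X < B" using that by auto
    have "complements A B X = {A<..<B} - {X}"
      by (rule complements_atom_coatom[OF Y _ _ X]) (fact atom coatom)+
    then have "W \<in> complements A B X" using that by simp
    then show ?thesis by (simp add: complements_def)
  qed
  have atoms: "\<not> X < W" if "A < X" "W \<in> {A<..<B}" for X W
  proof
    assume "X < W"
    then have "X < B" using that(2) by (auto intro: less_trans)
    then have "X \<in> {A<..<B}" using that(1) by simp
    moreover have "X \<noteq> W" "inf X W = X" using \<open>X < W\<close> by (simp_all add: inf_absorb1 less_imp_le)
    ultimately show False using inf_eq[of X W] that by simp
  qed
  have card_atom: "card (Rep_subspace W) = q * a" if "W \<in> {A<..<B}" for W
    using card_cover[of A W] atoms that by (simp add: q_def a_def)
  have card_B: "card (Rep_subspace B) = q * q * a"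
    using card_cover[of Y B] coatom card_atom[of Y] Y by (simp add: q_def)
  have "A < B" using Y by (rule less_trans)
  have union: "Rep_subspace B - Rep_subspace A = (\<Union>W\<in>{A<..<B}. Rep_subspace W - Rep_subspace A)"
  proof (intro equalityI subsetI)
    fix v assume v: "v \<in> Rep_subspace B - Rep_subspace A"
    define U where "U = adjoin A v"
    have "A < U" using v less_adjoin[of v A] by (simp add: U_def)
    have "U \<le> B" using v \<open>A < B\<close> by (simp add: U_def adjoin_le)
    \<comment> \<open>Adjoining one vector to \<open>A\<close> yields too few elements to fill
      \<open>B\<close>, so \<open>U\<close> is a middle subspace.\<close>
    have "card (Rep_subspace U) \<le> a * q"
      unfolding U_def Rep_adjoin
      using card_image_le[of "Rep_subspace A \<times> (UNIV :: 'a set)" "\<lambda>(a, c). a + c *s v"]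
      by (simp add: card_cartesian_product a_def q_def)
    also have "\<dots> < card (Rep_subspace B)" using q a by (simp add: card_B)
    finally have "U < B" using \<open>U \<le> B\<close> by (auto simp: less_le)
    then show "v \<in> (\<Union>W\<in>{A<..<B}. Rep_subspace W - Rep_subspace A)"
      using \<open>A < U\<close> adjoin_mem[of v A] v U_def by auto
  qed (auto simp: less_subspace_def)
  have "q * q * a - a = card (Rep_subspace B - Rep_subspace A)"
    using \<open>A < B\<close> by (simp add: card_B a_def card_Diff_subset less_subspace_def psubset_imp_subset)
  also have "\<dots> = (\<Sum>W\<in>{A<..<B}. card (Rep_subspace W - Rep_subspace A))"
    unfolding union
  proof (rule card_UN_disjoint)
    show "\<forall>X\<in>{A<..<B}. \<forall>W\<in>{A<..<B}. X \<noteq> W \<longrightarrow>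
        (Rep_subspace X - Rep_subspace A) \<inter> (Rep_subspace W - Rep_subspace A) = {}"
    proof (intro ballI impI)
      fix X W assume "X \<in> {A<..<B}" "W \<in> {A<..<B}" "X \<noteq> W"
      then have "Rep_subspace X \<inter> Rep_subspace W = Rep_subspace A"
        using inf_eq Rep_inf by metis
      then show "(Rep_subspace X - Rep_subspace A) \<inter> (Rep_subspace W - Rep_subspace A) = {}" by blast
    qed
  qed auto
  also have "\<dots> = (\<Sum>W\<in>{A<..<B}. q * a - a)"
    by (intro sum.cong refl)
      (auto simp: card_Diff_subset card_atom less_subspace_def psubset_imp_subset a_def)
  finally have eq: "q * q * a - a = card {A<..<B} * (q * a - a)" by simp
  have "q * q * a - a = (q + 1) * (q * a - a)"
    by (simp add: algebra_simps diff_mult_distrib2)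
  then have "card {A<..<B} * (q * a - a) = (q + 1) * (q * a - a)" using eq by simp
  \<comment> \<open>Cancelling this factor needs q \<ge> 2.\<close>
  moreover have "q * a - a > 0" using q a by simp
  ultimately have "card {A<..<B} = q + 1" by (metis mult_cancel2 less_not_refl)
  then show ?thesis by (simp add: q_def)
qed


section \<open>Eigenvalues of the two digraphs\<close>

text \<open>Reading the eigenvector along the inverse of the enumeration removes the list of
  vertices: the matrix acts on functions by summing over out-neighbours.\<close>

lemma nonzero_eigenvalue_function:
  assumes "\<mu> \<in> nonzero_eigenvalues G"
  shows "\<exists>f. (\<exists>x\<in>pverts G. f x \<noteq> 0) \<and>
    (\<forall>x\<in>pverts G. (\<Sum>y\<in>{y \<in> pverts G. (x, y) \<in> parcs G}. f y) = \<mu> * f x)"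
proof -
  obtain vs v where vs: "distinct vs" "set vs = pverts G" and
    ev: "eigenvector (adjacency_matrix G vs) v \<mu>"
    using assms by (auto simp: nonzero_eigenvalues_def eigenvalue_def)
  define N where "N = length vs"
  have v: "v \<in> carrier_vec N" "v \<noteq> 0\<^sub>v N" "adjacency_matrix G vs *\<^sub>v v = \<mu> \<cdot>\<^sub>v v"
    using ev by (auto simp: eigenvector_def adjacency_matrix_def N_def)
  have bij: "bij_betw ((!) vs) {..<N} (pverts G)"
    using bij_betw_nth[OF vs(1)] vs(2) by (simp add: N_def)
  define f where "f x = vec_index v (the_inv_into {..<N} ((!) vs) x)" for x
  have f: "f (vs ! i) = vec_index v i" if "i < N" for i
    using the_inv_into_f_f[OF bij_betw_imp_inj_on[OF bij], of i] that by (simp add: f_def)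
  have "finite (pverts G)" using vs(2) by (metis List.finite_set)
  show ?thesis
  proof (intro exI[of _ f] conjI ballI)
    have "\<exists>i<N. vec_index v i \<noteq> 0"
    proof (rule ccontr)
      assume "\<not> (\<exists>i<N. vec_index v i \<noteq> 0)"
      then have "v = 0\<^sub>v N" using v(1) by (intro eq_vecI) auto
      with v(2) show False ..
    qed
    then obtain i where "i < N" "vec_index v i \<noteq> 0" by blast
    then show "\<exists>x\<in>pverts G. f x \<noteq> 0"
      using f bij by (intro bexI[of _ "vs ! i"]) (auto simp: bij_betw_def)
  next
    fix x assume "x \<in> pverts G"
    then obtain i where i: "i < N" "x = vs ! i" using bij by (auto simp: bij_betw_def)
    have "\<mu> * f x = vec_index (adjacency_matrix G vs *\<^sub>v v) i"
      using v i by (simp add: f)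
    also have "\<dots> = (\<Sum>j<N. if (x, vs ! j) \<in> parcs G then f (vs ! j) else 0)"
      using v(1) i by (auto simp: adjacency_matrix_def scalar_prod_def N_def atLeast0LessThan f
          intro!: sum.cong)
    also have "\<dots> = (\<Sum>y\<in>pverts G. if (x, y) \<in> parcs G then f y else 0)"
      by (rule sum.reindex_bij_betw[OF bij])
    also have "\<dots> = (\<Sum>y\<in>{y \<in> pverts G. (x, y) \<in> parcs G}. f y)"
      using \<open>finite (pverts G)\<close> by (simp add: sum.inter_filter)
    finally show "(\<Sum>y\<in>{y \<in> pverts G. (x, y) \<in> parcs G}. f y) = \<mu> * f x" by simp
  qed
qed

section \<open>Vertices and arcs in terms of the lattice\<close>

lemma Rep_eqI: "vec.subspace W \<Longrightarrow> \<exists>w. W = Rep_subspace w"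
  by (metis Abs_subspace_inverse mem_Collect_eq)

lemma complements_iff: "u \<in> complements A B x \<longleftrightarrow>
    Rep_subspace x \<inter> Rep_subspace u = Rep_subspace A \<and> Rep_subspace x + Rep_subspace u = Rep_subspace B"
  by (simp add: complements_def Rep_inf Rep_sup flip: Rep_subspace_inject)

definition zero_subspace :: "('a::field, 'n::finite) subspace" where
  "zero_subspace = Abs_subspace {0}"

definition full_subspace :: "('a::field, 'n::finite) subspace" where
  "full_subspace = Abs_subspace UNIV"

lemma Rep_zero [simp]: "Rep_subspace zero_subspace = {0}"
  by (simp add: zero_subspace_def Abs_subspace_inverse vec.subspace_single_0)

lemma Rep_full [simp]: "Rep_subspace full_subspace = UNIV"
  by (simp add: full_subspace_def Abs_subspace_inverse vec.subspace_UNIV)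

lemma nonzero_proper_subspaces_iff:
  fixes W :: "('a::field ^ 'n::finite) set"
  shows "W \<in> nonzero_proper_subspaces UNIV \<longleftrightarrow>
    (\<exists>w. W = Rep_subspace w \<and> zero_subspace < w \<and> w < full_subspace)"
proof -
  have "{0} \<subseteq> Rep_subspace w" for w :: "('a, 'n) subspace"
    using vec.subspace_0[OF subspace_Rep[of w]] by simp
  then have "zero_subspace < w \<and> w < full_subspace \<longleftrightarrow> Rep_subspace w \<noteq> {0} \<and> Rep_subspace w \<subset> UNIV"
    for w :: "('a, 'n) subspace"
    by (auto simp: less_subspace_def)
  then show ?thesis
    unfolding nonzero_proper_subspaces_def using Rep_eqI[of W] by auto
qed

text \<open>The neighbours of a vertex are its complements between the zero and the full subspace,
  so the adjacency operator is \<open>S\<close> for the whole lattice.\<close>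

lemma X0_eigenvalue:
  assumes "\<mu> \<in> nonzero_eigenvalues (X0 (UNIV :: ('a::{field,finite} ^ 'n::finite) set))"
  shows "complement_eigenvalue (zero_subspace :: ('a, 'n) subspace) full_subspace \<mu>"
proof -
  let ?G = "X0 (UNIV :: ('a ^ 'n) set)" and ?A = "zero_subspace :: ('a, 'n) subspace"
  obtain f where f: "\<exists>x\<in>pverts ?G. f x \<noteq> 0"
      "\<And>x. x \<in> pverts ?G \<Longrightarrow> (\<Sum>y\<in>{y \<in> pverts ?G. (x, y) \<in> parcs ?G}. f y) = \<mu> * f x"
    using nonzero_eigenvalue_function[OF assms] by blast
  have verts: "W \<in> pverts ?G \<longleftrightarrow> (\<exists>w. W = Rep_subspace w \<and> ?A < w \<and> w < full_subspace)" for W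
    by (simp add: X0_def nonzero_proper_subspaces_iff)
  show ?thesis
    unfolding complement_eigenvalue_def
  proof (intro exI[of _ "\<lambda>w. f (Rep_subspace w)"] conjI allI impI)
    show "\<exists>x>?A. x < full_subspace \<and> f (Rep_subspace x) \<noteq> 0" using f(1) verts by auto
  next
    fix x assume x: "?A < x" "x < full_subspace"
    then have x': "Rep_subspace x \<in> pverts ?G" using verts by blast
    have "{y \<in> pverts ?G. (Rep_subspace x, y) \<in> parcs ?G} = Rep_subspace ` complements ?A full_subspace x"
    proof (intro equalityI subsetI)
      fix W assume "W \<in> {y \<in> pverts ?G. (Rep_subspace x, y) \<in> parcs ?G}"
      then show "W \<in> Rep_subspace ` complements ?A full_subspace x"
        using verts[of W] by (auto simp: X0_def is_direct_sum_def complements_iff)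
    next
      fix W assume "W \<in> Rep_subspace ` complements ?A full_subspace x"
      then obtain w where w: "W = Rep_subspace w" "w \<in> complements ?A full_subspace x" by blast
      then have W: "W \<in> pverts ?G" using complements_strict[OF w(2) x] verts by blast
      then show "W \<in> {y \<in> pverts ?G. (Rep_subspace x, y) \<in> parcs ?G}"
        using x' w by (simp add: X0_def is_direct_sum_def complements_iff)
    qed
    then have "(\<Sum>y\<in>Rep_subspace ` complements ?A full_subspace x. f y) = \<mu> * f (Rep_subspace x)"
      using f(2)[OF x'] by simp
    then show "complement_sum ?A full_subspace (\<lambda>w. f (Rep_subspace w)) x = \<mu> * f (Rep_subspace x)"
      by (simp add: complement_sum_def sum.reindex inj_on_def Rep_subspace_inject)
  qed
qed

text \<open>Every arc switches between increasing and decreasing flags: from (x, y) with x < y it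
  leads to (y, u) with u a complement of x below y, from (y, x) to (x, w) with w a complement of y
  above x. An eigenvector thus splits into parts \<open>f\<close> and \<open>h\<close> that
  \<open>lower\<close> and \<open>upper\<close> exchange.\<close>

lemma X2_eigenvalue:
  assumes "\<mu> \<in> nonzero_eigenvalues (X2 (UNIV :: ('a::{field,finite} ^ 'n::finite) set))"
  obtains f h where
    "f \<in> flag_functions (zero_subspace :: ('a, 'n) subspace) full_subspace"
    "h \<in> flag_functions zero_subspace full_subspace" "f \<noteq> 0 \<or> h \<noteq> 0"
    "lower zero_subspace full_subspace h = \<mu> *s f" "upper zero_subspace full_subspace f = \<mu> *s h" "\<mu> \<noteq> 0"
proof -
  let ?G = "X2 (UNIV :: ('a ^ 'n) set)" and ?A = "zero_subspace :: ('a, 'n) subspace"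
    and ?B = "full_subspace :: ('a, 'n) subspace"
  obtain e where e: "\<exists>x\<in>pverts ?G. e x \<noteq> 0"
      "\<And>x. x \<in> pverts ?G \<Longrightarrow> (\<Sum>y\<in>{y \<in> pverts ?G. (x, y) \<in> parcs ?G}. e y) = \<mu> * e x"
    using nonzero_eigenvalue_function[OF assms] by blast
  define f where "f = (\<chi> p. if p \<in> flags ?A ?B then e (Rep_subspace (fst p), Rep_subspace (snd p)) else 0)"
  \<comment> \<open>The values on decreasing flags are stored with the smaller subspace first, so
    that \<open>f\<close> and \<open>h\<close> share one index set.\<close>
  define h where "h = (\<chi> p. if p \<in> flags ?A ?B then e (Rep_subspace (snd p), Rep_subspace (fst p)) else 0)"
  have fh_in: "f \<in> flag_functions ?A ?B" "h \<in> flag_functions ?A ?B"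
    by (auto simp: f_def h_def flag_functions_def)
  have f_at: "f $ (x, y) = e (Rep_subspace x, Rep_subspace y)"
    and h_at: "h $ (x, y) = e (Rep_subspace y, Rep_subspace x)" if "?A < x" "x < y" "y < ?B" for x y
    using that by (simp_all add: f_def h_def flags_def)
  have verts: "p \<in> pverts ?G \<longleftrightarrow> (\<exists>x y. ?A < x \<and> x < y \<and> y < ?B \<and>
      (p = (Rep_subspace x, Rep_subspace y) \<or> p = (Rep_subspace y, Rep_subspace x)))" for p
  proof -
    obtain W U where p: "p = (W, U)" by (cases p)
    have dir: "p \<in> pverts ?G \<longleftrightarrow> W \<in> nonzero_proper_subspaces UNIV \<and>
        U \<in> nonzero_proper_subspaces UNIV \<and> (W \<subset> U \<or> U \<subset> W)"
      by (simp add: p X2_def directed_flags_def)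
    show ?thesis
    proof
      assume "p \<in> pverts ?G"
      then obtain x y where "W = Rep_subspace x" "U = Rep_subspace y" "?A < x" "x < ?B" "?A < y" "y < ?B"
          "x < y \<or> y < x"
        unfolding dir nonzero_proper_subspaces_iff less_subspace_def by blast
      then show "\<exists>x y. ?A < x \<and> x < y \<and> y < ?B \<and>
          (p = (Rep_subspace x, Rep_subspace y) \<or> p = (Rep_subspace y, Rep_subspace x))"
        unfolding p by metis
    next
      assume "\<exists>x y. ?A < x \<and> x < y \<and> y < ?B \<and>
          (p = (Rep_subspace x, Rep_subspace y) \<or> p = (Rep_subspace y, Rep_subspace x))"
      then obtain x y where xy: "?A < x" "x < y" "y < ?B"
          "p = (Rep_subspace x, Rep_subspace y) \<or> p = (Rep_subspace y, Rep_subspace x)"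
        by blast
      have "x < ?B" "?A < y" using less_trans[OF xy(2,3)] less_trans[OF xy(1,2)] by simp_all
      then have mem: "Rep_subspace x \<in> nonzero_proper_subspaces UNIV"
          "Rep_subspace y \<in> nonzero_proper_subspaces UNIV" "Rep_subspace x \<subset> Rep_subspace y"
        using xy by (auto simp: nonzero_proper_subspaces_iff simp flip: less_subspace_def)
      have "W = Rep_subspace x \<and> U = Rep_subspace y \<or> W = Rep_subspace y \<and> U = Rep_subspace x"
        using xy(4) p by simp
      then show "p \<in> pverts ?G" unfolding dir using mem by (elim disjE) simp_all
    qed
  qed
  have arcs: "(p, p') \<in> parcs ?G \<longleftrightarrow> p \<in> pverts ?G \<and> p' \<in> pverts ?G \<and> snd p = fst p' \<and>
      (fst p \<inter> snd p' = {0} \<and> fst p + snd p' = snd p \<or> fst p \<inter> snd p' = snd p \<and> fst p + snd p' = UNIV)"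
    for p p'
    by (cases p; cases p') (simp add: X2_def is_direct_sum_def)
  have lower_eq: "lower ?A ?B h = \<mu> *s f"
  proof (rule flag_functions_eqI[OF lower_in vec.subspace_scale[OF subspace_flag_functions fh_in(1)]])
    fix x y assume xy: "?A < x" "x < y" "y < ?B"
    let ?p = "(Rep_subspace x, Rep_subspace y)"
    have p: "?p \<in> pverts ?G" using xy verts by blast
    have "{p' \<in> pverts ?G. (?p, p') \<in> parcs ?G} =
        (\<lambda>u. (Rep_subspace y, Rep_subspace u)) ` complements ?A y x"
    proof (intro equalityI subsetI)
      fix p' assume "p' \<in> {p' \<in> pverts ?G. (?p, p') \<in> parcs ?G}"
      then have p': "p' \<in> pverts ?G" "fst p' = Rep_subspace y"
          "Rep_subspace x \<inter> snd p' = {0} \<and> Rep_subspace x + snd p' = Rep_subspace y \<or>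
           Rep_subspace x \<inter> snd p' = Rep_subspace y"
        using arcs by auto
      obtain u where u: "snd p' = Rep_subspace u" using p'(1) verts[of p'] by auto
      \<comment> \<open>An arc of the second kind would place \<open>y\<close> inside
        \<open>x\<close>, so only direct sums remain.\<close>
      have "\<not> Rep_subspace y \<subseteq> Rep_subspace x" using xy by (auto simp: less_subspace_def)
      then have "u \<in> complements ?A y x" using p'(3) u by (auto simp: complements_iff)
      then show "p' \<in> (\<lambda>u. (Rep_subspace y, Rep_subspace u)) ` complements ?A y x"
        using p'(2) u by (intro image_eqI[of _ _ u]) (auto simp: prod_eq_iff)
    next
      fix p' assume "p' \<in> (\<lambda>u. (Rep_subspace y, Rep_subspace u)) ` complements ?A y x"
      then obtain u where u: "p' = (Rep_subspace y, Rep_subspace u)" "u \<in> complements ?A y x" by blast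
      then have "p' \<in> pverts ?G" using complements_strict[OF u(2) xy(1,2)] xy(3) verts by blast
      then show "p' \<in> {p' \<in> pverts ?G. (?p, p') \<in> parcs ?G}"
        using arcs p u by (simp add: complements_iff)
    qed
    then have "\<mu> * f $ (x, y) =
        (\<Sum>p'\<in>(\<lambda>u. (Rep_subspace y, Rep_subspace u)) ` complements ?A y x. e p')"
      using e(2)[OF p] by (simp add: f_at[OF xy])
    also have "\<dots> = (\<Sum>u\<in>complements ?A y x. e (Rep_subspace y, Rep_subspace u))"
      by (simp add: sum.reindex inj_on_def Rep_subspace_inject)
    also have "\<dots> = (\<Sum>u\<in>complements ?A y x. h $ (u, y))"
      using complements_strict[of _ ?A y x] xy by (intro sum.cong refl) (simp add: h_at)
    finally show "lower ?A ?B h $ (x, y) = (\<mu> *s f) $ (x, y)" by (simp add: lower_at[OF xy])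
  qed
  have upper_eq: "upper ?A ?B f = \<mu> *s h"
  proof (rule flag_functions_eqI[OF upper_in vec.subspace_scale[OF subspace_flag_functions fh_in(2)]])
    fix x y assume xy: "?A < x" "x < y" "y < ?B"
    let ?p = "(Rep_subspace y, Rep_subspace x)"
    have p: "?p \<in> pverts ?G" using xy verts by blast
    have "{p' \<in> pverts ?G. (?p, p') \<in> parcs ?G} =
        (\<lambda>w. (Rep_subspace x, Rep_subspace w)) ` complements x ?B y"
    proof (intro equalityI subsetI)
      fix p' assume "p' \<in> {p' \<in> pverts ?G. (?p, p') \<in> parcs ?G}"
      then have p': "p' \<in> pverts ?G" "fst p' = Rep_subspace x"
          "Rep_subspace y + snd p' = Rep_subspace x \<or>
           Rep_subspace y \<inter> snd p' = Rep_subspace x \<and> Rep_subspace y + snd p' = UNIV"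
        using arcs by auto
      obtain w where w: "snd p' = Rep_subspace w" using p'(1) verts[of p'] by auto
      \<comment> \<open>Now the first kind is impossible: its sum contains \<open>y\<close> but
        would equal the smaller \<open>x\<close>.\<close>
      have "\<not> Rep_subspace y \<subseteq> Rep_subspace x" using xy by (auto simp: less_subspace_def)
      then have "w \<in> complements x ?B y"
        using p'(3) w subset_sum_left[of y w] by (auto simp: complements_iff)
      then show "p' \<in> (\<lambda>w. (Rep_subspace x, Rep_subspace w)) ` complements x ?B y"
        using p'(2) w by (intro image_eqI[of _ _ w]) (auto simp: prod_eq_iff)
    next
      fix p' assume "p' \<in> (\<lambda>w. (Rep_subspace x, Rep_subspace w)) ` complements x ?B y"
      then obtain w where w: "p' = (Rep_subspace x, Rep_subspace w)" "w \<in> complements x ?B y" by blast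
      then have "p' \<in> pverts ?G" using complements_strict[OF w(2) xy(2,3)] xy(1) verts by blast
      then show "p' \<in> {p' \<in> pverts ?G. (?p, p') \<in> parcs ?G}"
        using arcs p w by (simp add: complements_iff)
    qed
    then have "\<mu> * h $ (x, y) =
        (\<Sum>p'\<in>(\<lambda>w. (Rep_subspace x, Rep_subspace w)) ` complements x ?B y. e p')"
      using e(2)[OF p] by (simp add: h_at[OF xy])
    also have "\<dots> = (\<Sum>w\<in>complements x ?B y. e (Rep_subspace x, Rep_subspace w))"
      by (simp add: sum.reindex inj_on_def Rep_subspace_inject)
    also have "\<dots> = (\<Sum>w\<in>complements x ?B y. f $ (x, w))"
      using complements_strict[of _ x ?B y] xy by (intro sum.cong refl) (simp add: f_at)
    finally show "upper ?A ?B f $ (x, y) = (\<mu> *s h) $ (x, y)" by (simp add: upper_at[OF xy])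
  qed
  obtain p where p: "p \<in> pverts ?G" "e p \<noteq> 0" using e(1) by blast
  then obtain x y where xy: "?A < x" "x < y" "y < ?B"
      "p = (Rep_subspace x, Rep_subspace y) \<or> p = (Rep_subspace y, Rep_subspace x)"
    using verts by blast
  then have "f $ (x, y) \<noteq> 0 \<or> h $ (x, y) \<noteq> 0" using f_at h_at p(2) by auto
  then have "f \<noteq> 0 \<or> h \<noteq> 0" by auto
  moreover have "\<mu> \<noteq> 0" using assms by (simp add: nonzero_eigenvalues_def)
  ultimately show ?thesis using that[OF fh_in _ lower_eq upper_eq] by blast
qed

theorem theorem1p3p11:
  fixes q n :: nat
  assumes "CARD('a::{field,finite}) = q"
    and "CARD('n::finite) = n"
    and "n \<ge> 2"
  shows "(\<forall>\<mu> \<in> nonzero_eigenvalues (X0 (UNIV :: ('a ^ 'n) set)).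
            \<exists>\<zeta> s. root_of_unity \<zeta> \<and> s \<in> \<rat> \<and> \<mu> = \<zeta> * complex_of_real (real q powr s)) \<and>
         (\<forall>\<mu> \<in> nonzero_eigenvalues (X2 (UNIV :: ('a ^ 'n) set)).
            \<exists>\<zeta> s. root_of_unity \<zeta> \<and> s \<in> \<rat> \<and> \<mu> = \<zeta> * complex_of_real (real q powr s))"
proof -
  have q: "q > 0" using assms(1) by auto
  \<comment> \<open>Middle subspaces of an interval of length two correspond to the q + 1 points of
    a projective line, which starts the induction.\<close>
  have pp: "pure_power q \<mu>" if "complement_eigenvalue A B \<mu>" for A B :: "('a, 'n) subspace" and \<mu>
    by (rule complement_eigenvalue_pure_power[OF q _ that])
      (simp add: card_interval_length_2 flip: assms(1))
  have bp: "braid_pair q (flag_functions A B) (lower A B) (upper A B)" for A B :: "('a, 'n) subspace"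
    using braid_pair_lower_upper[OF q] pp by blast
  have "pure_power q \<mu>" if "\<mu> \<in> nonzero_eigenvalues (X0 (UNIV :: ('a ^ 'n) set))" for \<mu>
    using pp X0_eigenvalue[OF that] .
  moreover have "pure_power q \<mu>" if "\<mu> \<in> nonzero_eigenvalues (X2 (UNIV :: ('a ^ 'n) set))" for \<mu>
    by (rule X2_eigenvalue[OF that]) (rule pure_power_alternating[OF bp])
  ultimately show ?thesis
    using pure_power_imp_root_of_unity_times_powr[OF q] by blast
qed

end
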